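(* Let $K\subseteq\mathbb{R}^n$ be a compact convex subset with non-empty interior and $r\in\mathbb{N}\cup\{\infty\}$. Then the map $$\operatorname{Diff}^{C^r}_{\partial K}(K)\times K\to K,\quad(\phi,y)\mapsto\phi^{-1}(y)$$ is $C^r$.
   Context: All locally convex spaces are real and Hausdorff; $\mathbb{N}=\{1,2,\dots\}$. $C^r$-maps (Bastiani/Keller $C^r_c$). Let $E,F$ be locally convex spaces, $r\in\mathbb{N}_0\cup\{\infty\}$. For $U\subseteq E$ open, $f\colon U\to F$ is $C^r$ if it is continuous, the iterated directional derivatives $d^{(k)}f(x,y_1,\dots,y_k)=(D_{y_k}\cdots D_{y_1}f)(x)$ exist for all $k\in\mathbb{N}$, $k\le r$, $x\in U$, $y_i\in E$, and all $d^{(k)}f\colon U\times E^k\to F$ are continuous. If $U\subseteq E$ is a subset with dense interior $U^0$ that is locally convex (every $x\in U$ has a convex neighbourhood in $U$), then $f\colon U\to F$ is $C^r$ if $f$ is continuous, $f|_{U^0}$ is $C^r$ and each $d^{(k)}(f|_{U^0})$ ($k\le r$) has a continuous extension $d^{(k)}f\colon U\times E^k\to F$. The space $C^r(U,F)$ of $C^r$-maps carries the compact-open $C^r$-topology, i.e. the initial topology with respect to the maps $f\mapsto d^{(k)}f\in C(U\times E^k,F)$ ($k\in\mathbb{N}_0$, $k\le r$, $d^{(0)}f=f$), with compact-open topologies on the targets. A map into $K$ is $C^r$ if it is $C^r$ as a map into $\mathbb{R}^n$. $\operatorname{Diff}^{C^r}_{\partial K}(K)$ is the group of all bijections $\phi\colon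 K\to K$ such that $\phi$ and $\phi^{-1}$ are $C^r$ and $\phi|_{\partial K}=\operatorname{id}_{\partial K}$. $C^r_{\partial K}(K,\mathbb{R}^n)$ is the closed vector subspace of all $\gamma\in C^r(K,\mathbb{R}^n)$ with $\gamma|_{\partial K}=0$. The set $\Omega_r=\{\phi-\operatorname{id}_K:\phi\in\operatorname{Diff}^{C^r}_{\partial K}(K)\}$ is open in $C^r_{\partial K}(K,\mathbb{R}^n)$, and $\operatorname{Diff}^{C^r}_{\partial K}(K)$ is given the smooth manifold structure for which $\phi\mapsto\phi-\operatorname{id}_K$ is a global chart onto $\Omega_r$; thus the claim means that $\Omega_r\times K\to\mathbb{R}^n$, $(\gamma,y)\mapsto(\operatorname{id}_K+\gamma)^{-1}(y)$ is $C^r$. *)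

theory Defs
  imports "HOL-Analysis.Analysis" "HOL-Library.Function_Algebras" "HOL-Library.Extended_Nat"
begin

section \<open>Pointwise scalar multiplication\<close>

instantiation "fun" :: (type, scaleR) scaleR
begin

definition "c *\<^sub>R f = (\<lambda>x. c *\<^sub>R f x)"
instance ..

end

lemma scaleR_fun_apply [simp]: "(c *\<^sub>R f) x = c *\<^sub>R f x"
  by (simp add: scaleR_fun_def)

instance "fun" :: (type, real_vector) real_vector
  by standard (simp_all add: fun_eq_iff scaleR_add_right scaleR_add_left)


section \<open>Maps of class C^r (Bastiani, Keller)\<close>

text \<open>
  A locally convex space is given by a topology \<^term>\<open>T\<close> on a linear subspace
  \<^term>\<open>topspace T\<close> of a real vector space type. The definitions below are applied to
  Hausdorff locally convex spaces only. Orders of differentiability are elements of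
  \<^typ>\<open>enat\<close>. A tuple of directions (y_1, ..., y_k) is an element
  \<^term>\<open>ys\<close> of the k-fold power, indexed by \<^term>\<open>{1..k}\<close>.
\<close>

definition power_top :: "'a topology \<Rightarrow> nat \<Rightarrow> (nat \<Rightarrow> 'a) topology" where
  "power_top T k = product_topology (\<lambda>_. T) {1..k}"

definition jet_top :: "'a topology \<Rightarrow> 'a set \<Rightarrow> nat \<Rightarrow> ('a \<times> (nat \<Rightarrow> 'a)) topology" where
  "jet_top T U k = prod_topology (subtopology T U) (power_top T k)"

definition has_dir_deriv ::
  "'b::real_vector topology \<Rightarrow> ('a::real_vector \<Rightarrow> 'b) \<Rightarrow> 'a \<Rightarrow> 'a \<Rightarrow> 'b \<Rightarrow> bool" where
  "has_dir_deriv S f y x l \<longleftrightarrow>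
     limitin S (\<lambda>t::real. (1 / t) *\<^sub>R (f (x + t *\<^sub>R y) - f x)) l (at 0)"

definition dir_deriv ::
  "'b::real_vector topology \<Rightarrow> ('a::real_vector \<Rightarrow> 'b) \<Rightarrow> 'a \<Rightarrow> 'a \<Rightarrow> 'b" where
  "dir_deriv S f y x = (THE l. has_dir_deriv S f y x l)"

primrec iter_deriv ::
  "'b::real_vector topology \<Rightarrow> ('a::real_vector \<Rightarrow> 'b) \<Rightarrow> nat \<Rightarrow> 'a \<Rightarrow> (nat \<Rightarrow> 'a) \<Rightarrow> 'b" where
  "iter_deriv S f 0 x ys = f x"
| "iter_deriv S f (Suc k) x ys = dir_deriv S (\<lambda>z. iter_deriv S f k z ys) (ys (Suc k)) x"

definition Cr_on_open ::
  "enat \<Rightarrow> 'a::real_vector topology \<Rightarrow> 'a set \<Rightarrow> 'b::real_vector topology \<Rightarrow> ('a \<Rightarrow> 'b) \<Rightarrow> bool" where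
  "Cr_on_open r T U S f \<longleftrightarrow>
     openin T U \<and>
     continuous_map (subtopology T U) S f \<and>
     (\<forall>k. enat (Suc k) \<le> r \<longrightarrow>
        (\<forall>x\<in>U. \<forall>ys\<in>topspace (power_top T (Suc k)).
           \<exists>l. has_dir_deriv S (\<lambda>z. iter_deriv S f k z ys) (ys (Suc k)) x l) \<and>
        continuous_map (jet_top T U (Suc k)) S (\<lambda>(x, ys). iter_deriv S f (Suc k) x ys))"

definition locally_convex_in :: "'a::real_vector topology \<Rightarrow> 'a set \<Rightarrow> bool" where
  "locally_convex_in T U \<longleftrightarrow>
     (\<forall>x\<in>U. \<exists>W N. openin (subtopology T U) W \<and> x \<in> W \<and> W \<subseteq> N \<and> N \<subseteq> U \<and> convex N)"

definition extends_deriv ::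
  "'a::real_vector topology \<Rightarrow> 'a set \<Rightarrow> 'b::real_vector topology \<Rightarrow> ('a \<Rightarrow> 'b) \<Rightarrow> nat \<Rightarrow>
     ('a \<times> (nat \<Rightarrow> 'a) \<Rightarrow> 'b) \<Rightarrow> bool" where
  "extends_deriv T U S f k g \<longleftrightarrow>
     continuous_map (jet_top T U k) S g \<and>
     (\<forall>x\<in>T interior_of U. \<forall>ys\<in>topspace (power_top T k). g (x, ys) = iter_deriv S f k x ys)"

text \<open>
  The conditions on the domain (dense interior, local convexity) are part of the predicate.
  Values of \<^term>\<open>f\<close> outside \<^term>\<open>U\<close> are irrelevant.
\<close>

definition Cr_on ::
  "enat \<Rightarrow> 'a::real_vector topology \<Rightarrow> 'a set \<Rightarrow> 'b::real_vector topology \<Rightarrow> ('a \<Rightarrow> 'b) \<Rightarrow> bool" where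
  "Cr_on r T U S f \<longleftrightarrow>
     U \<subseteq> topspace T \<and> U \<subseteq> T closure_of (T interior_of U) \<and> locally_convex_in T U \<and>
     continuous_map (subtopology T U) S f \<and>
     Cr_on_open r T (T interior_of U) S f \<and>
     (\<forall>k. enat k \<le> r \<longrightarrow> (\<exists>g. extends_deriv T U S f k g))"


section \<open>The compact-open C^r-topology\<close>

definition compact_open_top :: "'a topology \<Rightarrow> 'b topology \<Rightarrow> ('a \<Rightarrow> 'b) topology" where
  "compact_open_top X Y = topology_generated_by
     {{g \<in> extensional (topspace X). continuous_map X Y g \<and> g ` Q \<subseteq> V} | Q V.
        compactin X Q \<and> openin Y V}"

text \<open>
  The extension of the k-th iterated derivative to U x E^k, unique on that set if the
  interior of U is dense and the target is Hausdorff; \<^const>\<open>extensional\<close> fixes the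
  irrelevant values elsewhere.
\<close>

definition ext_deriv ::
  "'a::real_vector topology \<Rightarrow> 'a set \<Rightarrow> 'b::real_vector topology \<Rightarrow> nat \<Rightarrow> ('a \<Rightarrow> 'b) \<Rightarrow>
     ('a \<times> (nat \<Rightarrow> 'a) \<Rightarrow> 'b)" where
  "ext_deriv T U S k f =
     (THE g. g \<in> extensional (topspace (jet_top T U k)) \<and> extends_deriv T U S f k g)"

text \<open>
  A function on U is represented by its extension by zero, so that the vector space
  operations are the pointwise ones of the function type.
\<close>

definition Cr_space ::
  "enat \<Rightarrow> 'a::real_vector topology \<Rightarrow> 'a set \<Rightarrow> 'b::real_vector topology \<Rightarrow> ('a \<Rightarrow> 'b) set" where
  "Cr_space r T U S = {f. Cr_on r T U S f \<and> (\<forall>x. x \<notin> U \<longrightarrow> f x = 0)}"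

text \<open>
  The initial topology with respect to a family of maps is the pullback of the product
  topology along the map into the product.
\<close>

definition Cr_top ::
  "enat \<Rightarrow> 'a::real_vector topology \<Rightarrow> 'a set \<Rightarrow> 'b::real_vector topology \<Rightarrow> ('a \<Rightarrow> 'b) topology" where
  "Cr_top r T U S =
     pullback_topology (Cr_space r T U S)
       (\<lambda>f. \<lambda>k\<in>{k. enat k \<le> r}. ext_deriv T U S k f)
       (product_topology (\<lambda>k. compact_open_top (jet_top T U k) S) {k. enat k \<le> r})"

lemma topspace_compact_open_top:
  "topspace (compact_open_top X Y) = {g \<in> extensional (topspace X). continuous_map X Y g}"
proof -
  let ?C = "{g \<in> extensional (topspace X). continuous_map X Y g}"
  have "?C \<in> {{g \<in> extensional (topspace X). continuous_map X Y g \<and> g ` Q \<subseteq> V} | Q V.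
        compactin X Q \<and> openin Y V}"
    by (rule CollectI, rule exI[of _ "{}"], rule exI[of _ "{}"]) auto
  then show ?thesis
    unfolding compact_open_top_def topology_generated_by_topspace by blast
qed

lemma extends_deriv_unique:
  assumes "Hausdorff_space S" "U \<subseteq> T closure_of (T interior_of U)"
    and g: "extends_deriv T U S f k g" and h: "extends_deriv T U S f k h"
    and p: "p \<in> topspace (jet_top T U k)"
  shows "g p = h p"
proof -
  let ?P = "topspace (power_top T k)"
  have "U \<inter> T closure_of (U \<inter> T interior_of U) = U \<inter> T closure_of (T interior_of U)"
    by (metis inf.absorb_iff2 interior_of_subset)
  then have "p \<in> jet_top T U k closure_of ((T interior_of U) \<times> ?P)"
    using p assms(2)
    by (auto simp: jet_top_def closure_of_Times closure_of_subtopology interior_of_subset)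
  then show ?thesis
    by (rule forall_in_closure_of_eq[OF _ assms(1)])
       (use g h in \<open>auto simp: extends_deriv_def\<close>)
qed

lemma ext_deriv:
  assumes "Hausdorff_space S" "Cr_on r T U S f" "enat k \<le> r"
  shows "ext_deriv T U S k f \<in> extensional (topspace (jet_top T U k))"
    and "extends_deriv T U S f k (ext_deriv T U S k f)"
proof -
  let ?J = "topspace (jet_top T U k)"
  obtain g where g: "extends_deriv T U S f k g"
    using assms(2,3) unfolding Cr_on_def by blast
  have dense: "U \<subseteq> T closure_of (T interior_of U)"
    using assms(2) by (simp add: Cr_on_def)
  let ?h = "restrict g ?J"
  have sub: "(x, ys) \<in> ?J" if "x \<in> T interior_of U" "ys \<in> topspace (power_top T k)" for x ys
    using that interior_of_subset[of T U] interior_of_subset_topspace[of T U] by (auto simp: jet_top_def)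
  have h: "extends_deriv T U S f k ?h"
    using g sub unfolding extends_deriv_def
    by (auto intro: continuous_map_eq)
  have "\<exists>!g. g \<in> extensional ?J \<and> extends_deriv T U S f k g"
  proof (rule ex1I[of _ ?h])
    show "?h \<in> extensional ?J \<and> extends_deriv T U S f k ?h" using h by simp
    fix g' assume "g' \<in> extensional ?J \<and> extends_deriv T U S f k g'"
    then show "g' = ?h"
      using extends_deriv_unique[OF assms(1) dense _ h] by (auto intro: extensionalityI)
  qed
  from theI'[OF this] show "ext_deriv T U S k f \<in> extensional ?J"
    and "extends_deriv T U S f k (ext_deriv T U S k f)"
    by (auto simp: ext_deriv_def)
qed

lemma topspace_Cr_top:
  assumes "Hausdorff_space S"
  shows "topspace (Cr_top r T U S) = Cr_space r T U S"
proof -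
  have "continuous_map (jet_top T U k) S (ext_deriv T U S k f)"
    if "Cr_on r T U S f" "enat k \<le> r" for f k
    using ext_deriv(2)[OF assms that] by (simp add: extends_deriv_def)
  then show ?thesis
    using ext_deriv(1)[OF assms]
    by (auto simp: Cr_top_def topspace_pullback_topology topspace_compact_open_top Cr_space_def)
qed


section \<open>Diffeomorphisms fixing the boundary\<close>

definition Cr_bd_top :: "enat \<Rightarrow> (real ^ 'n) set \<Rightarrow> (real ^ 'n \<Rightarrow> real ^ 'n) topology" where
  "Cr_bd_top r K =
     subtopology (Cr_top r euclidean K euclidean) {\<gamma>. \<forall>x\<in>frontier K. \<gamma> x = 0}"

definition Diff_bd :: "enat \<Rightarrow> (real ^ 'n) set \<Rightarrow> (real ^ 'n \<Rightarrow> real ^ 'n) set" where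
  "Diff_bd r K =
     {\<phi> \<in> extensional K. bij_betw \<phi> K K \<and>
        Cr_on r euclidean K euclidean \<phi> \<and>
        Cr_on r euclidean K euclidean (inv_into K \<phi>) \<and>
        (\<forall>x\<in>frontier K. \<phi> x = x)}"

definition Diff_chart :: "(real ^ 'n) set \<Rightarrow> (real ^ 'n \<Rightarrow> real ^ 'n) \<Rightarrow> (real ^ 'n \<Rightarrow> real ^ 'n)" where
  "Diff_chart K \<phi> = (\<lambda>x. if x \<in> K then \<phi> x - x else 0)"

definition Omega :: "enat \<Rightarrow> (real ^ 'n) set \<Rightarrow> (real ^ 'n \<Rightarrow> real ^ 'n) set" where
  "Omega r K = Diff_chart K ` Diff_bd r K"

end

(* Write F(g, y) for the solution x of x + g(x) = y. A function g vanishing on the boundary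
   corresponds to a diffeomorphism iff id + g maps K onto itself and expands distances at
   least by some factor c > 0: the inverse of a diffeomorphism is Lipschitz, K being convex and
   compact. This condition is open in the C^1-topology, since along the segment from g to a
   C^1-close function all maps stay injective, and then no interior point can be moved across
   the pointwise fixed boundary.

   The directional derivative of F at (g, y) along (h, v) is (1 + g'(x))^{-1} (v - h(x)) where
   x = F(g, y). By Cramer's rule, it belongs to an algebra generated by jets of g and of the
   directions at x, which is stable under directional derivatives and consists of functions that
   are continuous up to the boundary. This gives all higher derivatives of F and their
   extensions, and, for fixed g, it shows that the inverse of id + g is C^r. *)

theory Submission
  imports Defs
begin

section \<open>A criterion for maps of class C^r\<close>

text \<open>At frontier points derivatives exist only as continuous extensions from the interior, so
  every derivative of \<open>F\<close> must be given by a formula that makes sense on all of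
  \<open>Om \<times> K\<close>. A quantitative lower bound passes to the closure, where mere
  injectivity would not exclude a degenerate Jacobian. The topology of \<open>E\<close> enters only
  through the joint continuity of (\<gamma>, x) |-> jet of \<gamma> at x, for a fixed tuple of
  directions. Moving directions never occur: the chain rule expands along the coordinate axes, and
  the coordinates of the velocity become scalar factors. No order is lost. The velocity involves
  first-order jets of \<gamma> and values of the direction, and differentiating a jet raises its
  order by one; so the k-th derivative of \<open>F\<close> uses jets of order at most k, all of
  which exist for k \<le> r. Differentiation in \<gamma> is reduced to differentiation of
  \<open>F \<gamma>\<close> for one fixed \<gamma>, so that all calculus takes place in finite
  dimension.\<close>

lemma topspace_jet_top:
  "topspace (jet_top T U k) = (topspace T \<inter> U) \<times> ({1..k} \<rightarrow>\<^sub>E topspace T)"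
  by (simp add: jet_top_def power_top_def)

text \<open>Translates the limit of difference quotients, the form used for general targets, into a
  vector derivative, to which the rules of calculus apply.\<close>

lemma has_dir_deriv_euclidean:
  "has_dir_deriv euclidean f y x l \<longleftrightarrow> ((\<lambda>t. f (x + t *\<^sub>R y)) has_vector_derivative l) (at 0)"
proof -
  have "norm ((1 / t) *\<^sub>R (f (x + t *\<^sub>R y) - f x) - l)
      = norm (f (x + (0 + t) *\<^sub>R y) - f (x + 0 *\<^sub>R y) - t *\<^sub>R l) / norm t" if "t \<noteq> 0" for t :: real
  proof -
    have "(1 / t) *\<^sub>R (f (x + t *\<^sub>R y) - f x) - l = (1 / t) *\<^sub>R (f (x + t *\<^sub>R y) - f x - t *\<^sub>R l)"
      using that by (simp add: scaleR_diff_right)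
    then show ?thesis by (simp add: divide_inverse mult.commute)
  qed
  then have "((\<lambda>t. norm ((1 / t) *\<^sub>R (f (x + t *\<^sub>R y) - f x) - l)) \<longlongrightarrow> 0) (at 0) \<longleftrightarrow>
      ((\<lambda>t. norm (f (x + (0 + t) *\<^sub>R y) - f (x + 0 *\<^sub>R y) - t *\<^sub>R l) / norm t) \<longlongrightarrow> 0) (at 0)"
    by (intro Lim_cong_within) auto
  then show ?thesis
    unfolding has_dir_deriv_def limitin_canonical_iff has_vector_derivative_def has_derivative_at
    by (subst Lim_null, subst (asm) tendsto_norm_zero_iff) (simp add: bounded_linear_scaleR_left)
qed

text \<open>The filter \<open>at 0\<close> excludes t = 0, while the quotient also contains the
  value at x; hence the separate equation there.\<close>

lemma has_dir_deriv_transform: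
  assumes "has_dir_deriv S f y x l" and "\<forall>\<^sub>F t in at 0. f (x + t *\<^sub>R y) = g (x + t *\<^sub>R y)" "f x = g x"
  shows "has_dir_deriv S g y x l"
  using assms(1) unfolding has_dir_deriv_def
  by (rule limitin_transform_eventually[rotated]) (use assms(2,3) in \<open>auto elim: eventually_mono\<close>)

lemma dir_deriv_eq:
  assumes "Hausdorff_space S" "has_dir_deriv S f y x l"
  shows "dir_deriv S f y x = l"
  unfolding dir_deriv_def
proof (rule the_equality)
  show "has_dir_deriv S f y x l" by fact
  fix l' assume "has_dir_deriv S f y x l'"
  then show "l' = l"
    using assms unfolding has_dir_deriv_def
    by (auto intro: limitin_Hausdorff_unique)
qed

text \<open>The functions \<open>h k\<close> are candidates for the extended derivatives. On the
  interior, uniqueness of limits identifies them with the iterated derivatives; elsewhere only their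
  continuity matters. The tuple \<open>\<lambda>_. undefined\<close> is the empty one. Openness of
  the interior along lines is the hypothesis \<open>path\<close>, since no compatibility of
  \<open>T\<close> with the vector operations is assumed.\<close>

lemma Cr_onI:
  assumes S: "Hausdorff_space S"
    and U: "U \<subseteq> topspace T" "U \<subseteq> T closure_of (T interior_of U)" "locally_convex_in T U"
    and cont: "\<And>k. enat k \<le> r \<Longrightarrow> continuous_map (jet_top T U k) S (h k)"
    and zero: "\<And>x. x \<in> U \<Longrightarrow> h 0 (x, \<lambda>_. undefined) = f x"
    and step: "\<And>k x ys. enat (Suc k) \<le> r \<Longrightarrow> x \<in> T interior_of U \<Longrightarrow>
        ys \<in> {1..Suc k} \<rightarrow>\<^sub>E topspace T \<Longrightarrow>
        has_dir_deriv S (\<lambda>z. h k (z, restrict ys {1..k})) (ys (Suc k)) x (h (Suc k) (x, ys))"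
    and path: "\<And>x y. x \<in> T interior_of U \<Longrightarrow> y \<in> topspace T \<Longrightarrow>
        \<forall>\<^sub>F t in at 0. x + t *\<^sub>R y \<in> T interior_of U"
  shows "Cr_on r T U S f" and "\<And>k. enat k \<le> r \<Longrightarrow> extends_deriv T U S f k (h k)"
proof -
  let ?V = "T interior_of U"
  have VU: "?V \<subseteq> U" by (rule interior_of_subset)
  \<comment> \<open>The recursion of \<open>iter_deriv\<close> hands the whole tuple down, so at
    level k it may have more than k entries and has to be cut off before it enters
    \<open>h k\<close>.\<close>
  have iter: "iter_deriv S f k x ys = h k (x, restrict ys {1..k})"
    if "enat k \<le> r" "x \<in> ?V" "ys \<in> {1..k} \<rightarrow> topspace T" for k x ys
    using that
  proof (induction k arbitrary: x)
    case 0
    then show ?case using zero VU by auto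
  next
    case (Suc k)
    have k: "enat k \<le> r" using Suc.prems(1) by (metis Suc_ile_eq order_less_imp_le)
    have eq: "iter_deriv S f k z ys = h k (z, restrict ys {1..k})" if "z \<in> ?V" for z
      by (rule Suc.IH[OF k that]) (use Suc.prems(3) in \<open>auto simp: Pi_iff\<close>)
    have "has_dir_deriv S (\<lambda>z. h k (z, restrict (restrict ys {1..Suc k}) {1..k}))
        ((restrict ys {1..Suc k}) (Suc k)) x (h (Suc k) (x, restrict ys {1..Suc k}))"
      by (rule step) (use Suc.prems in \<open>auto simp: Pi_iff\<close>)
    moreover have "restrict (restrict ys {1..Suc k}) {1..k} = restrict ys {1..k}" by auto
    ultimately have d: "has_dir_deriv S (\<lambda>z. h k (z, restrict ys {1..k}))
        (ys (Suc k)) x (h (Suc k) (x, restrict ys {1..Suc k}))"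
      by simp
    have "has_dir_deriv S (\<lambda>z. iter_deriv S f k z ys) (ys (Suc k)) x (h (Suc k) (x, restrict ys {1..Suc k}))"
    proof (rule has_dir_deriv_transform[OF d])
      have "\<forall>\<^sub>F t in at 0. x + t *\<^sub>R ys (Suc k) \<in> ?V"
        by (rule path) (use Suc.prems in \<open>auto simp: Pi_iff\<close>)
      then show "\<forall>\<^sub>F t in at 0. h k (x + t *\<^sub>R ys (Suc k), restrict ys {1..k}) =
          iter_deriv S f k (x + t *\<^sub>R ys (Suc k)) ys"
        by (rule eventually_mono) (simp add: eq)
    qed (use eq Suc.prems in simp)
    then show ?case unfolding iter_deriv.simps by (rule dir_deriv_eq[OF S])
  qed
  have iterE: "iter_deriv S f k x ys = h k (x, ys)"
    if "enat k \<le> r" "x \<in> ?V" "ys \<in> {1..k} \<rightarrow>\<^sub>E topspace T" for k x ys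
    using iter[OF that(1,2), of ys] that(3) PiE_restrict[OF that(3)] by (simp add: PiE_def)
  show ext: "extends_deriv T U S f k (h k)" if "enat k \<le> r" for k
    unfolding extends_deriv_def power_top_def topspace_product_topology
    using cont[OF that] iterE[OF that] by simp
  have contf: "continuous_map (subtopology T U) S f"
  proof -
    have "continuous_map (subtopology T U) (jet_top T U 0) (\<lambda>x. (x, \<lambda>_. undefined))"
      unfolding jet_top_def power_top_def by (intro continuous_intros) auto
    from continuous_map_compose[OF this cont[of 0]] show ?thesis
      by (rule continuous_map_eq) (use zero U(1) in \<open>auto simp: zero_enat_def[symmetric]\<close>)
  qed
  have "Cr_on_open r T ?V S f"
    unfolding Cr_on_open_def
  proof (intro conjI allI impI ballI)
    show "openin T ?V" by simp
    show "continuous_map (subtopology T ?V) S f"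
      by (rule continuous_map_from_subtopology_mono[OF contf VU])
    fix k assume k: "enat (Suc k) \<le> r"
    then have k': "enat k \<le> r" by (metis Suc_ile_eq order_less_imp_le)
    {
      fix x ys assume x: "x \<in> ?V" and "ys \<in> topspace (power_top T (Suc k))"
      then have ys: "ys \<in> {1..Suc k} \<rightarrow>\<^sub>E topspace T" by (simp add: power_top_def)
      have eq: "iter_deriv S f k z ys = h k (z, restrict ys {1..k})" if "z \<in> ?V" for z
        by (rule iter[OF k' that]) (use ys in \<open>auto simp: Pi_iff\<close>)
      have "has_dir_deriv S (\<lambda>z. iter_deriv S f k z ys) (ys (Suc k)) x (h (Suc k) (x, ys))"
      proof (rule has_dir_deriv_transform[OF step[OF k x ys]])
        have "\<forall>\<^sub>F t in at 0. x + t *\<^sub>R ys (Suc k) \<in> ?V"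
          by (rule path[OF x]) (use ys in \<open>auto simp: Pi_iff\<close>)
        then show "\<forall>\<^sub>F t in at 0. h k (x + t *\<^sub>R ys (Suc k), restrict ys {1..k}) =
            iter_deriv S f k (x + t *\<^sub>R ys (Suc k)) ys"
          by (rule eventually_mono) (simp add: eq)
      qed (use eq x in simp)
      then show "\<exists>l. has_dir_deriv S (\<lambda>z. iter_deriv S f k z ys) (ys (Suc k)) x l" by blast
    }
    have "continuous_map (jet_top T ?V (Suc k)) S (h (Suc k))"
    proof -
      have "jet_top T ?V (Suc k) = subtopology (jet_top T U (Suc k)) (?V \<times> UNIV)"
        unfolding jet_top_def
        by (simp add: subtopology_Times subtopology_subtopology Int_absorb1[OF VU])
      then show ?thesis by (simp add: continuous_map_from_subtopology cont[OF k])
    qed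
    then show "continuous_map (jet_top T ?V (Suc k)) S (\<lambda>(x, ys). iter_deriv S f (Suc k) x ys)"
    proof (rule continuous_map_eq)
      fix p assume "p \<in> topspace (jet_top T ?V (Suc k))"
      then have "fst p \<in> ?V" "snd p \<in> {1..Suc k} \<rightarrow>\<^sub>E topspace T"
        by (simp_all only: topspace_jet_top mem_Times_iff Int_iff)
      from iterE[OF k this] show "h (Suc k) p = (\<lambda>(x, ys). iter_deriv S f (Suc k) x ys) p"
        by (simp only: case_prod_beta prod.collapse)
    qed
  qed
  with ext U contf show "Cr_on r T U S f" unfolding Cr_on_def by blast
qed

section \<open>Functions on a convex body\<close>

text \<open>The classical argument: change one coordinate at a time and apply the mean value
  inequality to each change. Being C^r provides directional derivatives only, and this is the bridge
  to Frechet derivatives.\<close>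

lemma has_derivative_continuous_partials:
  fixes f :: "real ^ 'n \<Rightarrow> 'b::real_normed_vector"
  assumes "open U" "x \<in> U"
    and partial: "\<And>z j. z \<in> U \<Longrightarrow> ((\<lambda>t. f (z + t *\<^sub>R axis j 1)) has_vector_derivative g j z) (at 0)"
    and cont: "\<And>j. continuous (at x) (g j)"
  shows "(f has_derivative (\<lambda>h. \<Sum>j\<in>UNIV. (h $ j) *\<^sub>R g j x)) (at x)"
proof -
  \<comment> \<open>\<open>P S h\<close> switches on the coordinates of h in S; the induction adds
    one coordinate after another.\<close>
  define P :: "'n set \<Rightarrow> real ^ 'n \<Rightarrow> real ^ 'n" where "P S h = (\<chi> i. if i \<in> S then h $ i else 0)" for S h
  have claim: "\<exists>d>0. \<forall>h. norm h < d \<longrightarrow>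
      norm (f (x + P S h) - f x - (\<Sum>j\<in>S. (h $ j) *\<^sub>R g j x)) \<le> e * norm h"
    if "finite S" "e > 0" for S and e :: real
    using that
  proof (induction S arbitrary: e)
    case empty
    have "P {} h = 0" for h by (simp add: P_def vec_eq_iff)
    then show ?case using empty by (intro exI[of _ 1]) auto
  next
    case (insert j S)
    obtain d1 where d1: "d1 > 0" "\<And>h. norm h < d1 \<Longrightarrow>
        norm (f (x + P S h) - f x - (\<Sum>j\<in>S. (h $ j) *\<^sub>R g j x)) \<le> e/2 * norm h"
      using insert.IH[of "e/2"] insert.prems by auto
    obtain d2 where d2: "d2 > 0" "\<And>z. dist z x < d2 \<Longrightarrow> dist (g j z) (g j x) < e/2"
      using cont[of j] insert.prems unfolding continuous_at_eps_delta by (meson half_gt_zero)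
    obtain d3 where d3: "d3 > 0" "ball x d3 \<subseteq> U"
      using assms(1,2) open_contains_ball by blast
    have "norm (f (x + P (insert j S) h) - f x - (\<Sum>i\<in>insert j S. (h $ i) *\<^sub>R g i x)) \<le> e * norm h"
      if h: "norm h < Min {d1, d2, d3}" for h
    proof -
      define z where "z s = x + P S h + s *\<^sub>R axis j 1" for s :: real
      \<comment> \<open>Subtracting the linear part leaves the derivative
        \<open>g j (z s) - g j x\<close>, which the choice of \<open>d2\<close> keeps below
        e/2.\<close>
      let ?\<phi> = "\<lambda>s. f (z s) - s *\<^sub>R g j x"
      have z: "norm (z s - x) \<le> norm h" if "s \<in> closed_segment 0 (h $ j)" for s
      proof (rule norm_le_componentwise_cart)
        fix i
        have "\<bar>s\<bar> \<le> \<bar>h $ j\<bar>" using that by (auto simp: closed_segment_eq_real_ivl split: if_splits)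
        then show "norm ((z s - x) $ i) \<le> norm (h $ i)"
          using insert.hyps by (auto simp: z_def P_def axis_def)
      qed
      have deriv: "(?\<phi> has_derivative (\<lambda>t. t *\<^sub>R (g j (z s) - g j x))) (at s within closed_segment 0 (h $ j))"
        if s: "s \<in> closed_segment 0 (h $ j)" for s
      proof -
        have "z s \<in> U"
          using z[OF s] h d3 by (auto simp: dist_norm norm_minus_commute subset_iff)
        have "((\<lambda>t. t - s) has_vector_derivative 1) (at s)"
          by (auto intro!: derivative_eq_intros)
        from vector_diff_chain_at[OF this, of "\<lambda>t. f (z s + t *\<^sub>R axis j 1)" "g j (z s)"]
          partial[OF \<open>z s \<in> U\<close>, of j]
        have "((\<lambda>t. f (z s + (t - s) *\<^sub>R axis j 1)) has_vector_derivative g j (z s)) (at s)"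
          by (simp add: o_def)
        moreover have "(\<lambda>t. f (z s + (t - s) *\<^sub>R axis j 1)) = (\<lambda>t. f (z t))"
          by (simp add: z_def algebra_simps)
        ultimately have "((\<lambda>t. f (z t)) has_vector_derivative g j (z s)) (at s)" by simp
        then have "(?\<phi> has_vector_derivative (g j (z s) - g j x)) (at s)"
          by (auto intro!: derivative_eq_intros)
        then show ?thesis
          by (simp add: has_vector_derivative_def has_derivative_at_withinI)
      qed
      have "norm (?\<phi> (h $ j) - ?\<phi> 0) \<le> e/2 * norm (h $ j - 0)"
      proof (rule differentiable_bound[OF convex_closed_segment deriv])
        fix s assume s: "s \<in> closed_segment 0 (h $ j)"
        have "norm (g j (z s) - g j x) \<le> e/2"
          using d2(2)[of "z s"] z[OF s] h by (auto simp: dist_norm)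
        then have "\<bar>t\<bar> * norm (g j (z s) - g j x) \<le> \<bar>t\<bar> * (e/2)" for t
          by (rule mult_left_mono) simp
        then show "onorm (\<lambda>t. t *\<^sub>R (g j (z s) - g j x)) \<le> e/2"
          by (intro onorm_le) (simp add: mult.commute)
      qed auto
      also have "\<dots> \<le> e/2 * norm h"
        using insert.prems component_le_norm_cart[of h j] by (simp add: mult_left_mono)
      finally have 1: "norm (?\<phi> (h $ j) - ?\<phi> 0) \<le> e/2 * norm h" .
      have z0: "z 0 = x + P S h" by (simp add: z_def)
      have zj: "z (h $ j) = x + P (insert j S) h"
        using insert.hyps by (auto simp: z_def P_def vec_eq_iff axis_def)
      have "f (x + P (insert j S) h) - f x - (\<Sum>i\<in>insert j S. (h $ i) *\<^sub>R g i x)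
          = (?\<phi> (h $ j) - ?\<phi> 0) + (f (x + P S h) - f x - (\<Sum>i\<in>S. (h $ i) *\<^sub>R g i x))"
        using insert.hyps by (simp add: z0 zj)
      then have "norm (f (x + P (insert j S) h) - f x - (\<Sum>i\<in>insert j S. (h $ i) *\<^sub>R g i x))
          \<le> norm (?\<phi> (h $ j) - ?\<phi> 0) + norm (f (x + P S h) - f x - (\<Sum>i\<in>S. (h $ i) *\<^sub>R g i x))"
        by (simp only: norm_triangle_ineq)
      also have "\<dots> \<le> e/2 * norm h + e/2 * norm h"
        using 1 d1(2)[of h] h by simp
      finally show ?thesis by simp
    qed
    then show ?case
      using d1(1) d2(1) d3(1) by (intro exI[of _ "Min {d1, d2, d3}"]) auto
  qed
  have "bounded_linear (\<lambda>h. \<Sum>j\<in>UNIV. (h $ j) *\<^sub>R g j x)"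
    by (intro bounded_linear_sum bounded_linear_scaleR_const bounded_linear_vec_nth)
  moreover have "\<exists>d>0. \<forall>y. norm (y - x) < d \<longrightarrow>
      norm (f y - f x - (\<Sum>j\<in>UNIV. ((y - x) $ j) *\<^sub>R g j x)) \<le> e * norm (y - x)" if "e > 0" for e
  proof -
    have "P UNIV h = h" for h by (simp add: P_def)
    with claim[OF finite that, of UNIV] obtain d where d: "d > 0" "\<And>h. norm h < d \<Longrightarrow>
      norm (f (x + h) - f x - (\<Sum>j\<in>UNIV. (h $ j) *\<^sub>R g j x)) \<le> e * norm h" by auto
    show ?thesis
      using d(1) d(2)[of "y - x" for y] by (intro exI[of _ d]) simp
  qed
  ultimately show ?thesis unfolding has_derivative_at_alt by blast
qed

section \<open>Jets: derivatives extended to the frontier\<close>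

lemma iter_deriv_cong:
  assumes "\<And>i. i \<in> {1..k} \<Longrightarrow> ys i = zs i"
  shows "iter_deriv S f k x ys = iter_deriv S f k x zs"
  using assms by (induction k arbitrary: x) auto

text \<open>The restriction makes the irrelevant entries of \<^term>\<open>ws\<close> harmless.\<close>

definition jet :: "(real ^ 'n) set \<Rightarrow> nat \<Rightarrow> (real ^ 'n \<Rightarrow> real ^ 'n) \<Rightarrow> real ^ 'n \<Rightarrow> (nat \<Rightarrow> real ^ 'n) \<Rightarrow> real ^ 'n"
  where "jet K k f x ws = ext_deriv euclidean K euclidean k f (x, restrict ws {1..k})"

locale convex_body =
  fixes K :: "(real ^ 'n) set" and r :: enat
  assumes compact: "compact K" and convex: "convex K" and interior: "interior K \<noteq> {}" and r: "1 \<le> r"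
begin

abbreviation "Cr \<equiv> Cr_on r euclidean K (euclidean :: (real ^ 'n) topology)"

lemma closure_interior_K: "closure (interior K) = K"
  using convex_closure_interior[OF convex interior] compact by (simp add: compact_imp_closed)

lemma interior_K_dense: "K \<subseteq> euclidean closure_of (euclidean interior_of K)"
  by (simp add: closure_interior_K)

lemma locally_convex_K: "locally_convex_in euclidean K"
  unfolding locally_convex_in_def using convex by (metis openin_subtopology_self order_refl)

lemma interior_path: "x \<in> interior K \<Longrightarrow> \<forall>\<^sub>F t in at 0. x + t *\<^sub>R y \<in> interior K"
proof -
  assume x: "x \<in> interior K"
  have "((\<lambda>t. x + t *\<^sub>R y) \<longlongrightarrow> x + 0 *\<^sub>R y) (at 0)" by (intro tendsto_intros)
  then show ?thesis using x by (auto dest: topological_tendstoD[OF _ open_interior])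
qed

lemma topspace_jet_K: "topspace (jet_top euclidean K k) = K \<times> ({1..k} \<rightarrow>\<^sub>E UNIV)"
  by (simp add: topspace_jet_top)

lemma extends_jet:
  assumes "Cr f" "enat k \<le> r"
  shows "extends_deriv euclidean K euclidean f k (ext_deriv euclidean K euclidean k f)"
  by (rule ext_deriv(2)[OF _ assms]) simp

lemma jet_unique:
  assumes "Cr f" "enat k \<le> r" "extends_deriv euclidean K euclidean f k h" "x \<in> K"
  shows "jet K k f x ws = h (x, restrict ws {1..k})"
  unfolding jet_def
  by (rule extends_deriv_unique[OF _ interior_K_dense extends_jet[OF assms(1,2)] assms(3)])
    (use assms(4) in \<open>auto simp: topspace_jet_K\<close>)

lemma jet_iter:
  assumes "Cr f" "enat k \<le> r" "x \<in> interior K"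
  shows "jet K k f x ws = iter_deriv euclidean f k x ws"
proof -
  have "jet K k f x ws = iter_deriv euclidean f k x (restrict ws {1..k})"
    using extends_jet[OF assms(1,2)] assms(3) unfolding jet_def extends_deriv_def
    by (auto simp: power_top_def)
  also have "\<dots> = iter_deriv euclidean f k x ws" by (rule iter_deriv_cong) auto
  finally show ?thesis .
qed

lemma jet_cong: "(\<And>i. i \<in> {1..k} \<Longrightarrow> ws i = ws' i) \<Longrightarrow> jet K k f x ws = jet K k f x ws'"
  unfolding jet_def by (simp cong: restrict_cong)

lemma continuous_on_jet:
  assumes "Cr f" "enat k \<le> r"
  shows "continuous_on K (\<lambda>x. jet K k f x ws)"
proof -
  have "continuous_map (top_of_set K) (jet_top euclidean K k) (\<lambda>x. (x, restrict ws {1..k}))"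
    unfolding jet_top_def power_top_def by (intro continuous_intros) (auto simp: id_def[symmetric])
  from continuous_map_compose[OF this] extends_jet[OF assms]
  show ?thesis
    unfolding extends_deriv_def jet_def o_def by (auto simp flip: continuous_map_iff_continuous)
qed

text \<open>Holds on the frontier too, since f is itself a continuous extension of its derivative of
  order 0.\<close>

lemma jet_0: "Cr f \<Longrightarrow> x \<in> K \<Longrightarrow> jet K 0 f x ws = f x"
proof -
  assume f: "Cr f" and x: "x \<in> K"
  have "continuous_map (jet_top euclidean K 0) euclidean (f \<circ> fst)"
    by (rule continuous_map_compose[where X' = "top_of_set K"])
      (use f in \<open>auto simp: jet_top_def Cr_on_def intro: continuous_intros\<close>)
  then have "extends_deriv euclidean K euclidean f 0 (f \<circ> fst)"
    by (simp add: extends_deriv_def)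
  from jet_unique[OF f _ this x] show ?thesis by (simp flip: zero_enat_def)
qed

lemma jet_step:
  assumes "Cr f" "enat (Suc k) \<le> r" "x \<in> interior K"
  shows "((\<lambda>t. jet K k f (x + t *\<^sub>R ws (Suc k)) ws) has_vector_derivative jet K (Suc k) f x ws) (at 0)"
proof -
  have k: "enat k \<le> r" using assms(2) by (metis Suc_ile_eq order_less_imp_le)
  let ?ws = "restrict ws {1..Suc k}"
  have "\<exists>l. has_dir_deriv euclidean (\<lambda>z. iter_deriv euclidean f k z ?ws) (?ws (Suc k)) x l"
    using assms unfolding Cr_on_def Cr_on_open_def
    by (auto simp: power_top_def simp del: restrict_apply)
  moreover have eq: "iter_deriv euclidean f k z ?ws = iter_deriv euclidean f k z ws" for z
    by (rule iter_deriv_cong) auto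
  ultimately obtain l where l: "has_dir_deriv euclidean (\<lambda>z. iter_deriv euclidean f k z ws) (ws (Suc k)) x l"
    by auto
  then have "l = iter_deriv euclidean f (Suc k) x ws"
    by (simp add: dir_deriv_eq)
  moreover have "has_dir_deriv euclidean (\<lambda>z. jet K k f z ws) (ws (Suc k)) x l"
  proof (rule has_dir_deriv_transform[OF l])
    show "\<forall>\<^sub>F t in at 0. iter_deriv euclidean f k (x + t *\<^sub>R ws (Suc k)) ws =
        jet K k f (x + t *\<^sub>R ws (Suc k)) ws"
      using interior_path[OF assms(3), of "ws (Suc k)"]
      by (rule eventually_mono) (simp add: jet_iter[OF assms(1) k])
  qed (simp add: jet_iter[OF assms(1) k assms(3)])
  ultimately show ?thesis
    using jet_iter[OF assms] by (simp add: has_dir_deriv_euclidean)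
qed

text \<open>Needed for the chain rule along curved paths such as t |-> F(\<gamma> + t \<eta>, y + t
  v), where directional derivatives do not suffice. Only axis directions appear, so the remaining
  directions stay fixed.\<close>

lemma jet_has_derivative:
  assumes "Cr f" "enat (Suc k) \<le> r" "x \<in> interior K"
  shows "((\<lambda>z. jet K k f z ws) has_derivative
      (\<lambda>h. \<Sum>j\<in>UNIV. (h $ j) *\<^sub>R jet K (Suc k) f x (ws(Suc k := axis j 1)))) (at x)"
proof (rule has_derivative_continuous_partials[OF open_interior assms(3),
      where g = "\<lambda>j z. jet K (Suc k) f z (ws(Suc k := axis j 1))"])
  fix z j assume "z \<in> interior K"
  moreover have "jet K k f y (ws(Suc k := axis j 1)) = jet K k f y ws" for y
    by (rule jet_cong) auto
  ultimately show "((\<lambda>t. jet K k f (z + t *\<^sub>R axis j 1) ws) has_vector_derivative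
      jet K (Suc k) f z (ws(Suc k := axis j 1))) (at 0)"
    using jet_step[OF assms(1,2), of z "ws(Suc k := axis j 1)"] by simp
next
  fix j
  show "continuous (at x) (\<lambda>z. jet K (Suc k) f z (ws(Suc k := axis j 1)))"
  proof -
    have "continuous_on K (\<lambda>z. jet K (Suc k) f z (ws(Suc k := axis j 1)))"
      by (rule continuous_on_jet[OF assms(1,2)])
    then show ?thesis by (rule continuous_on_interior) (rule assms(3))
  qed
qed

text \<open>The same combination of the extended derivatives satisfies \<open>Cr_onI\<close>;
  uniqueness of extensions then makes jets linear up to the frontier.\<close>

lemma Cr_lincomb:
  assumes "Cr f" "Cr g" and eq: "\<And>x. x \<in> K \<Longrightarrow> h x = a *\<^sub>R f x + b *\<^sub>R g x"
  shows "Cr h" and "\<And>k x ws. enat k \<le> r \<Longrightarrow> x \<in> K \<Longrightarrow>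
      jet K k h x ws = a *\<^sub>R jet K k f x ws + b *\<^sub>R jet K k g x ws"
proof -
  let ?e = "ext_deriv euclidean K (euclidean :: (real ^ 'n) topology)"
  let ?h = "\<lambda>k p. a *\<^sub>R ?e k f p + b *\<^sub>R ?e k g p"
  have cont: "continuous_map (jet_top euclidean K k) euclidean (?h k)" if "enat k \<le> r" for k
    using extends_jet[OF assms(1) that] extends_jet[OF assms(2) that]
    unfolding extends_deriv_def by (auto simp: continuous_map_atin intro!: tendsto_intros)
  have zero: "?h 0 (x, \<lambda>_. undefined) = h x" if "x \<in> K" for x
    using jet_0[OF assms(1) that, of "\<lambda>_. undefined"] jet_0[OF assms(2) that, of "\<lambda>_. undefined"]
    by (simp add: jet_def eq[OF that] restrict_def)
  have step: "has_dir_deriv euclidean (\<lambda>z. ?h k (z, restrict ys {1..k})) (ys (Suc k)) x (?h (Suc k) (x, ys))"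
    if "enat (Suc k) \<le> r" "x \<in> euclidean interior_of K" "ys \<in> {1..Suc k} \<rightarrow>\<^sub>E topspace euclidean" for k x ys
  proof -
    have "x \<in> interior K" using that by simp
    from jet_step[OF assms(1) that(1) this, of ys] jet_step[OF assms(2) that(1) this, of ys] that(3)
    show ?thesis
      unfolding has_dir_deriv_euclidean jet_def
      by (auto intro!: derivative_eq_intros simp: PiE_def extensional_restrict)
  qed
  note * = Cr_onI[OF _ _ interior_K_dense locally_convex_K cont zero step]
  show "Cr h" by (rule *) (auto intro: interior_path)
  fix k x ws assume "enat k \<le> r" "x \<in> K"
  show "jet K k h x ws = a *\<^sub>R jet K k f x ws + b *\<^sub>R jet K k g x ws"
    by (subst jet_unique[OF \<open>Cr h\<close> \<open>enat k \<le> r\<close> *(2)])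
      (auto intro: interior_path simp: \<open>x \<in> K\<close> \<open>enat k \<le> r\<close> jet_def)
qed

end

section \<open>Perturbations small in the C^1-topology\<close>

text \<open>The tube lemma: the complement is the projection of a closed set along a compact factor,
  and such projections are closed maps.\<close>

lemma openin_forall_less_compact:
  fixes h :: "'a \<times> 'b::t2_space \<Rightarrow> real"
  assumes "compact K" "continuous_map (prod_topology X (top_of_set K)) euclideanreal h"
  shows "openin X {\<gamma> \<in> topspace X. \<forall>x\<in>K. h (\<gamma>, x) < e}"
proof -
  have "compact_space (top_of_set K)"
    using assms(1) by (simp add: compact_space_subtopology)
  then have "closed_map (prod_topology X (top_of_set K)) X fst"
    by (rule closed_map_fst)
  moreover have "closedin (prod_topology X (top_of_set K))
      {p \<in> topspace (prod_topology X (top_of_set K)). h p \<in> {e..}}"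
    by (rule closedin_continuous_map_preimage[OF assms(2)]) simp
  ultimately have "closedin X (fst ` {p \<in> topspace (prod_topology X (top_of_set K)). h p \<in> {e..}})"
    unfolding closed_map_def by blast
  moreover have "fst ` {p \<in> topspace (prod_topology X (top_of_set K)). h p \<in> {e..}} =
      topspace X - {\<gamma> \<in> topspace X. \<forall>x\<in>K. h (\<gamma>, x) < e}"
    by (force simp: not_less)
  ultimately show ?thesis by (simp add: openin_closedin_eq)
qed

context convex_body
begin

abbreviation "T \<equiv> Cr_bd_top r K"
abbreviation "E \<equiv> topspace T"

text \<open>The boundary condition and the convention of extending by zero merge into one condition:
  vanishing off the interior.\<close>

lemma E_iff: "\<gamma> \<in> E \<longleftrightarrow> Cr \<gamma> \<and> (\<forall>x. x \<notin> interior K \<longrightarrow> \<gamma> x = 0)"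
proof -
  have "x \<notin> interior K \<longleftrightarrow> x \<notin> K \<or> x \<in> frontier K" for x
    using compact_imp_closed[OF compact] interior_subset[of K] by (auto simp: frontier_def)
  then show ?thesis
    by (auto simp: Cr_bd_top_def topspace_Cr_top Cr_space_def)
qed

lemma E_Cr: "\<gamma> \<in> E \<Longrightarrow> Cr \<gamma>"
  by (simp add: E_iff)

lemma E_lincomb: "\<gamma> \<in> E \<Longrightarrow> \<eta> \<in> E \<Longrightarrow> a *\<^sub>R \<gamma> + b *\<^sub>R \<eta> \<in> E"
  using Cr_lincomb(1)[of \<gamma> \<eta> "a *\<^sub>R \<gamma> + b *\<^sub>R \<eta>" a b] by (simp add: E_iff)

lemma E_path: "\<gamma> \<in> E \<Longrightarrow> \<eta> \<in> E \<Longrightarrow> \<gamma> + t *\<^sub>R \<eta> \<in> E"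
  using E_lincomb[of \<gamma> \<eta> 1 t] by simp

lemma zero_E: "0 \<in> E"
proof -
  have "Cr 0"
    by (rule Cr_onI[where h = "\<lambda>_ _. 0", OF _ _ interior_K_dense locally_convex_K])
      (auto intro: interior_path simp: has_dir_deriv_def)
  then show ?thesis by (simp add: E_iff)
qed

lemma jet_lincomb:
  assumes "\<gamma> \<in> E" "\<eta> \<in> E" "enat k \<le> r" "x \<in> K"
  shows "jet K k (a *\<^sub>R \<gamma> + b *\<^sub>R \<eta>) x ws = a *\<^sub>R jet K k \<gamma> x ws + b *\<^sub>R jet K k \<eta> x ws"
  by (rule Cr_lincomb(2)[OF E_Cr[OF assms(1)] E_Cr[OF assms(2)] _ assms(3,4)]) simp

lemma jet_path:
  assumes "\<gamma> \<in> E" "\<eta> \<in> E" "enat k \<le> r" "x \<in> K"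
  shows "jet K k (\<gamma> + t *\<^sub>R \<eta>) x ws = jet K k \<gamma> x ws + t *\<^sub>R jet K k \<eta> x ws"
  using jet_lincomb[OF assms, of 1 t] by simp

lemma continuous_map_ext_deriv:
  assumes "enat k \<le> r"
  shows "continuous_map T (compact_open_top (jet_top euclidean K k) euclidean) (ext_deriv euclidean K euclidean k)"
proof -
  let ?\<Phi> = "\<lambda>f. \<lambda>k\<in>{k. enat k \<le> r}. ext_deriv euclidean K (euclidean :: (real ^ 'n) topology) k f"
  have "continuous_map (Cr_top r euclidean K euclidean)
      (compact_open_top (jet_top euclidean K k) euclidean) ((\<lambda>u. u k) \<circ> ?\<Phi>)"
    unfolding Cr_top_def
    by (rule continuous_map_pullback[OF continuous_map_product_projection]) (use assms in simp)
  then show ?thesis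
    unfolding Cr_bd_top_def by (simp add: o_def assms continuous_map_from_subtopology)
qed

text \<open>With the directions fixed, Q times a single tuple is compact in the jet space, so this
  is the preimage of a subbasic set of the compact-open topology.\<close>

lemma openin_jet_image:
  assumes "enat k \<le> r" "compact Q" "Q \<subseteq> K" "open V"
  shows "openin T {\<gamma> \<in> E. \<forall>x\<in>Q. jet K k \<gamma> x ws \<in> V}"
proof -
  let ?J = "jet_top euclidean K k" and ?e = "ext_deriv euclidean K (euclidean :: (real ^ 'n) topology) k"
  let ?Q = "Q \<times> {restrict ws {1..k}}"
  have "compactin ?J ?Q"
    unfolding jet_top_def power_top_def
    using assms(2,3) by (auto simp: compactin_Times compactin_subtopology)
  then have "openin (compact_open_top ?J euclidean)
      {g \<in> extensional (topspace ?J). continuous_map ?J euclidean g \<and> g ` ?Q \<subseteq> V}"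
    unfolding compact_open_top_def
    by (intro topology_generated_by_Basis) (use assms(4) in auto)
  from openin_continuous_map_preimage[OF continuous_map_ext_deriv[OF assms(1)] this]
  moreover have "?e \<gamma> \<in> extensional (topspace ?J)" "continuous_map ?J euclidean (?e \<gamma>)" if "\<gamma> \<in> E" for \<gamma>
    using ext_deriv[OF _ E_Cr[OF that] assms(1)] by (auto simp: extends_deriv_def)
  ultimately show ?thesis
    by (simp add: jet_def image_subset_iff cong: conj_cong)
qed

text \<open>Evaluation is jointly continuous because K is locally compact. All later continuity
  statements on \<open>E\<close> rest on this one.\<close>

lemma continuous_map_jet:
  assumes "enat k \<le> r"
  shows "continuous_map (prod_topology T (top_of_set K)) euclidean (\<lambda>(\<gamma>, x). jet K k \<gamma> x ws)"
  unfolding continuous_map_eq_topcontinuous_at topcontinuous_at_def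
proof (intro ballI conjI allI impI)
  fix p V assume p: "p \<in> topspace (prod_topology T (top_of_set K))"
    and V: "openin euclidean V \<and> (\<lambda>(\<gamma>, x). jet K k \<gamma> x ws) p \<in> V"
  obtain \<gamma> x where px: "p = (\<gamma>, x)" "\<gamma> \<in> E" "x \<in> K" using p by auto
  have "continuous (at x within K) (\<lambda>x. jet K k \<gamma> x ws)"
    using continuous_on_jet[OF E_Cr[OF px(2)] assms] px(3) by (simp add: continuous_on_eq_continuous_within)
  then have "\<forall>\<^sub>F z in at x within K. jet K k \<gamma> z ws \<in> V"
    using V px unfolding continuous_within by (auto dest: topological_tendstoD)
  then obtain d where d: "d > 0" "\<And>z. z \<in> K \<Longrightarrow> dist z x < d \<Longrightarrow> jet K k \<gamma> z ws \<in> V"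
    using V px unfolding eventually_at by (metis case_prod_conv)
  \<comment> \<open>A compact neighbourhood of x in K that the jet of \<gamma> maps into V; sending
    it into V is an open condition on the first argument.\<close>
  let ?Q = "K \<inter> cball x (d/2)"
  let ?N = "{\<gamma> \<in> E. \<forall>x\<in>?Q. jet K k \<gamma> x ws \<in> V}"
  let ?W = "?N \<times> (K \<inter> ball x (d/2))"
  have "openin T ?N"
    by (rule openin_jet_image) (use assms V compact in \<open>auto intro: compact_Int\<close>)
  then have "openin (prod_topology T (top_of_set K)) ?W"
    by (simp add: openin_prod_Times_iff openin_open_Int)
  moreover have "p \<in> ?W" using px d by (auto simp: dist_commute)
  moreover have "\<forall>y\<in>?W. (\<lambda>(\<gamma>, x). jet K k \<gamma> x ws) y \<in> V" by auto
  ultimately show "\<exists>U. openin (prod_topology T (top_of_set K)) U \<and> p \<in> U \<and>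
      (\<forall>y\<in>U. (\<lambda>(\<gamma>, x). jet K k \<gamma> x ws) y \<in> V)"
    by blast
qed auto

section \<open>First partial derivatives and C^1-neighbourhoods\<close>

definition partial :: "'n \<Rightarrow> (real ^ 'n \<Rightarrow> real ^ 'n) \<Rightarrow> real ^ 'n \<Rightarrow> real ^ 'n"
  where "partial j f x = jet K 1 f x (\<lambda>_. axis j 1)"

lemma r1: "enat (Suc 0) \<le> r"
  using r by (simp add: one_enat_def)

lemma has_derivative_partials:
  assumes "Cr f" "x \<in> interior K"
  shows "(f has_derivative (\<lambda>h. \<Sum>j\<in>UNIV. (h $ j) *\<^sub>R partial j f x)) (at x)"
proof -
  have "jet K (Suc 0) f x ((\<lambda>_. 0)(Suc 0 := axis j 1)) = partial j f x" for j
    unfolding partial_def One_nat_def by (rule jet_cong) simp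
  with jet_has_derivative[OF assms(1) r1 assms(2), of "\<lambda>_. 0"]
  have "((\<lambda>z. jet K 0 f z (\<lambda>_. 0)) has_derivative (\<lambda>h. \<Sum>j\<in>UNIV. (h $ j) *\<^sub>R partial j f x)) (at x)"
    by simp
  then show ?thesis
    by (rule has_derivative_transform_within_open[OF _ open_interior assms(2)])
      (use interior_subset jet_0[OF assms(1)] in blast)
qed

lemma continuous_on_partial: "Cr f \<Longrightarrow> continuous_on K (partial j f)"
  unfolding partial_def using continuous_on_jet r1 by auto

lemma partial_bounded:
  assumes "Cr f"
  obtains M where "M > 0" "\<And>x j. x \<in> K \<Longrightarrow> norm (partial j f x) \<le> M"
proof -
  have "\<exists>M. \<forall>x\<in>K. norm (partial j f x) \<le> M" for j
    using compact_imp_bounded[OF compact_continuous_image[OF continuous_on_partial[OF assms] compact]]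
    unfolding bounded_iff by auto
  then obtain M where M: "\<And>j x. x \<in> K \<Longrightarrow> norm (partial j f x) \<le> M j" by metis
  have "norm (partial j f x) \<le> 1 + (\<Sum>j\<in>UNIV. \<bar>M j\<bar>)" if "x \<in> K" for j x
    using M[OF that, of j] member_le_sum[of j UNIV "\<lambda>j. \<bar>M j\<bar>"] by simp
  moreover have "1 + (\<Sum>j\<in>UNIV. \<bar>M j\<bar>) > 0" by (simp add: add_pos_nonneg sum_nonneg)
  ultimately show thesis using that by blast
qed

text \<open>The mean value inequality on the convex interior, carried to K by density. The factor
  \<open>CARD('n)\<close> arises from bounding each of the n coordinates of h by its norm.\<close>

lemma Cr_Lipschitz:
  assumes "Cr f" and M: "\<And>x j. x \<in> K \<Longrightarrow> norm (partial j f x) \<le> M" and "x \<in> K" "y \<in> K"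
  shows "norm (f x - f y) \<le> (real CARD('n) * M) * norm (x - y)"
proof -
  have int: "norm (f x - f y) \<le> (real CARD('n) * M) * norm (x - y)" if "x \<in> interior K" "y \<in> interior K" for x y
  proof (rule differentiable_bound[OF convex_interior[OF convex]])
    fix z assume z: "z \<in> interior K"
    then have zK: "z \<in> K" using interior_subset by blast
    show "(f has_derivative (\<lambda>h. \<Sum>j\<in>UNIV. (h $ j) *\<^sub>R partial j f z)) (at z within interior K)"
      by (rule has_derivative_at_withinI[OF has_derivative_partials[OF assms(1) z]])
    show "onorm (\<lambda>h. \<Sum>j\<in>UNIV. (h $ j) *\<^sub>R partial j f z) \<le> real CARD('n) * M"
    proof (rule onorm_le)
      fix h :: "real ^ 'n"
      have "norm (\<Sum>j\<in>UNIV. (h $ j) *\<^sub>R partial j f z) \<le> (\<Sum>j\<in>(UNIV::'n set). norm h * M)"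
        by (intro sum_norm_le)
          (auto intro!: mult_mono M[OF zK] simp: component_le_norm_cart)
      then show "norm (\<Sum>j\<in>UNIV. (h $ j) *\<^sub>R partial j f z) \<le> real CARD('n) * M * norm h"
        by (simp add: mult_ac)
    qed
  qed (use that in auto)
  have clos: "closure (interior K \<times> interior K) = K \<times> K"
    by (simp add: closure_Times closure_interior_K)
  have "continuous_on (K \<times> K) (\<lambda>p. norm (f (fst p) - f (snd p)) - (real CARD('n) * M) * norm (fst p - snd p))"
  proof -
    have f: "continuous_on K f" using assms(1) by (simp add: Cr_on_def)
    have "continuous_on (K \<times> K) (\<lambda>p. f (fst p))" "continuous_on (K \<times> K) (\<lambda>p. f (snd p))"
      by (auto intro!: continuous_on_compose2[OF f] continuous_intros)
    then show ?thesis by (intro continuous_intros)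
  qed
  from continuous_le_on_closure[of "interior K \<times> interior K", unfolded clos, OF this, of "(x, y)" 0]
  show ?thesis using assms(3,4) int by fastforce
qed

text \<open>Only first partials are compared. Elements of \<open>E\<close> vanish on the frontier,
  so by \<open>Cr_Lipschitz\<close> closeness of the values is implied.\<close>

definition C1_nbhd :: "(real ^ 'n \<Rightarrow> real ^ 'n) \<Rightarrow> real \<Rightarrow> (real ^ 'n \<Rightarrow> real ^ 'n) set"
  where "C1_nbhd \<gamma> e = {\<eta> \<in> E. \<forall>x\<in>K. \<forall>j. norm (partial j \<eta> x - partial j \<gamma> x) < e}"

lemma openin_C1_nbhd:
  assumes "\<gamma> \<in> E"
  shows "openin T (C1_nbhd \<gamma> e)"
proof -
  have "openin T {\<eta> \<in> E. \<forall>x\<in>K. norm (partial j \<eta> x - partial j \<gamma> x) < e}" for j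
  proof -
    have 1: "continuous_map (prod_topology T (top_of_set K)) euclidean (\<lambda>p. partial j (fst p) (snd p))"
      using continuous_map_jet[of 1 "\<lambda>_. axis j 1"] r1 by (simp add: partial_def case_prod_unfold)
    have "continuous_map (top_of_set K) euclidean (partial j \<gamma>)"
      using continuous_on_partial[OF E_Cr[OF assms]] by simp
    then have 2: "continuous_map (prod_topology T (top_of_set K)) euclidean (\<lambda>p. partial j \<gamma> (snd p))"
      by (rule continuous_map_compose[OF continuous_map_snd, unfolded o_def])
    have "continuous_map (prod_topology T (top_of_set K)) euclideanreal
        (\<lambda>p. norm (partial j (fst p) (snd p) - partial j \<gamma> (snd p)))"
      by (intro continuous_map_norm continuous_map_diff 1 2)
    from openin_forall_less_compact[OF compact this] show ?thesis by simp
  qed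
  then have "openin T (\<Inter>j. {\<eta> \<in> E. \<forall>x\<in>K. norm (partial j \<eta> x - partial j \<gamma> x) < e})"
    by (intro openin_Inter) auto
  moreover have "(\<Inter>j. {\<eta> \<in> E. \<forall>x\<in>K. norm (partial j \<eta> x - partial j \<gamma> x) < e}) = C1_nbhd \<gamma> e"
    by (auto simp: C1_nbhd_def)
  ultimately show ?thesis by simp
qed

text \<open>Provides the convex neighbourhoods for the local convexity of
  \<open>Om \<times> K\<close>. Membership says that linear maps of \<eta> take values in
  balls.\<close>

lemma convex_C1_nbhd: "convex (C1_nbhd \<gamma> e)"
proof (rule convexI)
  fix \<eta> \<zeta> and u v :: real
  assume h: "\<eta> \<in> C1_nbhd \<gamma> e" "\<zeta> \<in> C1_nbhd \<gamma> e" and uv: "0 \<le> u" "0 \<le> v" "u + v = 1"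
  then have E: "\<eta> \<in> E" "\<zeta> \<in> E" by (auto simp: C1_nbhd_def)
  have "norm (partial j (u *\<^sub>R \<eta> + v *\<^sub>R \<zeta>) x - partial j \<gamma> x) < e" if x: "x \<in> K" for x j
  proof -
    have "partial j \<eta> x \<in> ball (partial j \<gamma> x) e" "partial j \<zeta> x \<in> ball (partial j \<gamma> x) e"
      using h x by (auto simp: C1_nbhd_def dist_norm norm_minus_commute)
    from convexD[OF convex_ball this uv]
    show ?thesis
      using jet_lincomb[OF E _ x, of 1 u v "\<lambda>_. axis j 1"] r1
      by (simp add: partial_def dist_norm norm_minus_commute)
  qed
  then show "u *\<^sub>R \<eta> + v *\<^sub>R \<zeta> \<in> C1_nbhd \<gamma> e" using E_lincomb[OF E] by (simp add: C1_nbhd_def)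
qed

lemma C1_nbhd_self: "\<gamma> \<in> E \<Longrightarrow> e > 0 \<Longrightarrow> \<gamma> \<in> C1_nbhd \<gamma> e"
  by (simp add: C1_nbhd_def)

text \<open>A direct bound replaces an appeal to continuity of the vector operations on
  \<open>E\<close>: partials of \<eta> are bounded by M on the compact set K, so |t| < e/M is
  enough.\<close>

lemma C1_nbhd_path:
  assumes "\<gamma> \<in> E" "\<eta> \<in> E" "e > 0"
  shows "\<forall>\<^sub>F t in at 0. \<gamma> + t *\<^sub>R \<eta> \<in> C1_nbhd \<gamma> e"
proof -
  obtain M where M: "M > 0" "\<And>x j. x \<in> K \<Longrightarrow> norm (partial j \<eta> x) \<le> M"
    using partial_bounded[OF E_Cr[OF assms(2)]] by blast
  have "\<gamma> + t *\<^sub>R \<eta> \<in> C1_nbhd \<gamma> e" if "\<bar>t\<bar> < e / M" for t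
  proof -
    have "norm (partial j (\<gamma> + t *\<^sub>R \<eta>) x - partial j \<gamma> x) < e" if "x \<in> K" for x j
    proof -
      have "norm (partial j (\<gamma> + t *\<^sub>R \<eta>) x - partial j \<gamma> x) = \<bar>t\<bar> * norm (partial j \<eta> x)"
        using jet_path[OF assms(1,2) _ \<open>x \<in> K\<close>, of 1] r1 by (simp add: partial_def)
      also have "\<dots> \<le> \<bar>t\<bar> * M" by (simp add: M(2)[OF that] mult_left_mono)
      also have "\<dots> < e" using \<open>\<bar>t\<bar> < e / M\<close> M(1) by (simp add: pos_less_divide_eq)
      finally show ?thesis .
    qed
    then show ?thesis using E_path[OF assms(1,2)] by (simp add: C1_nbhd_def)
  qed
  then show ?thesis
    unfolding eventually_at by (intro exI[of _ "e / M"]) (use assms M in \<open>auto simp: dist_norm\<close>)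
qed

text \<open>
  This turns out to be \<^const>\<open>Omega\<close>. The lower bound makes it easy to see that the set is open,
  and it controls the Jacobian up to the boundary.
\<close>

definition Om :: "(real ^ 'n \<Rightarrow> real ^ 'n) set"
  where "Om = {\<gamma> \<in> E. (\<lambda>x. x + \<gamma> x) ` K = K \<and>
    (\<exists>c>0. \<forall>x\<in>K. \<forall>y\<in>K. c * norm (x - y) \<le> norm ((x + \<gamma> x) - (y + \<gamma> y)))}"

text \<open>The radius is chosen so that \<open>Cr_Lipschitz\<close>, with its factor
  \<open>CARD('n)\<close>, gives \<eta> - \<gamma> the Lipschitz constant c/2. Every map on the
  segment then keeps the lower bound c - c/2 = c/2.\<close>

lemma Om_perturb:
  assumes \<gamma>: "\<gamma> \<in> E" "(\<lambda>x. x + \<gamma> x) ` K = K" and c: "c > 0"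
    "\<And>x y. x \<in> K \<Longrightarrow> y \<in> K \<Longrightarrow> c * norm (x - y) \<le> norm ((x + \<gamma> x) - (y + \<gamma> y))"
    and \<eta>: "\<eta> \<in> C1_nbhd \<gamma> (c / (2 * CARD('n)))"
  shows "\<eta> \<in> Om"
proof -
  \<comment> \<open>The difference \<eta> - \<gamma>, spelled as a linear combination to match
    \<open>E_lincomb\<close> and \<open>jet_lincomb\<close>.\<close>
  let ?\<delta> = "1 *\<^sub>R \<eta> + (-1) *\<^sub>R \<gamma>"
  have \<eta>E: "\<eta> \<in> E" using \<eta> by (simp add: C1_nbhd_def)
  have \<delta>E: "?\<delta> \<in> E" by (rule E_lincomb[OF \<eta>E \<gamma>(1)])
  have "norm (partial j ?\<delta> x) \<le> c / (2 * CARD('n))" if "x \<in> K" for j x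
    using \<eta> that jet_lincomb[OF \<eta>E \<gamma>(1) _ that, of 1 1 "-1" "\<lambda>_. axis j 1"] r1
    by (auto simp: C1_nbhd_def partial_def intro: less_imp_le)
  from Cr_Lipschitz[OF E_Cr[OF \<delta>E] this]
  have lip: "norm (?\<delta> x - ?\<delta> y) \<le> c/2 * norm (x - y)" if "x \<in> K" "y \<in> K" for x y
    using that by simp
  define f where "f s x = (x + \<gamma> x) + s *\<^sub>R ?\<delta> x" for s :: real and x
  have low: "c/2 * norm (x - y) \<le> norm (f s x - f s y)" if "s \<in> {0..1}" "x \<in> K" "y \<in> K" for s x y
  proof -
    have "norm (s *\<^sub>R (?\<delta> x - ?\<delta> y)) \<le> c/2 * norm (x - y)"
      using lip[OF that(2,3)] that(1) mult_left_le_one_le[of "norm (?\<delta> x - ?\<delta> y)" s]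
      by simp
    moreover have "f s x - f s y = ((x + \<gamma> x) - (y + \<gamma> y)) - - (s *\<^sub>R (?\<delta> x - ?\<delta> y))"
      by (simp add: f_def algebra_simps)
    then have "norm ((x + \<gamma> x) - (y + \<gamma> y)) - norm (s *\<^sub>R (?\<delta> x - ?\<delta> y)) \<le> norm (f s x - f s y)"
      by (metis norm_triangle_ineq2 norm_minus_cancel)
    ultimately show ?thesis using c(2)[OF that(2,3)] by simp
  qed
  have inj: "inj_on (f s) K" if "s \<in> {0..1}" for s
    using low[OF that] c(1) by (intro inj_onI) (force simp: mult_le_0_iff)
  have out: "f s x = x" if "x \<notin> interior K" for s x
    using that \<gamma>(1) \<delta>E by (simp add: E_iff f_def)
  have front: "frontier K \<subseteq> K" "frontier K \<inter> interior K = {}" "K = interior K \<union> frontier K"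
    using compact_imp_closed[OF compact] interior_subset[of K] by (auto simp: frontier_def)
  \<comment> \<open>A frontier point f s x is fixed by f s, so it has the two preimages x and f s x;
    injectivity makes them equal, although x is interior.\<close>
  have nofront: "f s x \<notin> frontier K" if "s \<in> {0..1}" "x \<in> interior K" for s x
  proof
    assume *: "f s x \<in> frontier K"
    then have "f s (f s x) = f s x" using out front by blast
    then have "f s x = x" using inj[OF that(1)] * that(2) front by (auto dest!: inj_onD)
    with * that front show False by auto
  qed
  have cont: "continuous_on K (f s)" for s
    using E_Cr[OF \<gamma>(1)] E_Cr[OF \<delta>E] unfolding f_def
    by (intro continuous_intros) (simp_all add: Cr_on_def)
  \<comment> \<open>The path s |-> f s x starts in K, because id + \<gamma> maps K to K, and a
    connected set that misses the frontier cannot leave K.\<close>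
  have into: "f 1 x \<in> interior K" if x: "x \<in> interior K" for x
  proof -
    let ?p = "(\<lambda>s. f s x) ` {0..1}"
    have "connected ?p"
      unfolding f_def by (intro connected_continuous_image continuous_intros) simp
    moreover have "x \<in> K" using x interior_subset by blast
    then have "f 0 x \<in> ?p \<inter> K" using imageI[of x K "\<lambda>x. x + \<gamma> x"] \<gamma>(2) by (auto simp: f_def)
    moreover have "?p \<inter> frontier K = {}" using nofront[OF _ x] by auto
    ultimately have "?p \<subseteq> K" using connected_Int_frontier[of ?p K] by blast
    then have "f 1 x \<in> K" by (simp add: image_subset_iff)
    then show ?thesis using nofront[of 1, OF _ x] front(3) by auto
  qed
  \<comment> \<open>The image of the interior is open by invariance of domain and relatively closed
    because f 1 maps K to a compact set; connectedness of the interior finishes.\<close>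
  have onto: "interior K \<subseteq> f 1 ` interior K"
  proof -
    have "continuous_on (interior K) (f 1)" "inj_on (f 1) (interior K)"
      using cont[of 1] inj[of 1] interior_subset[of K] by (auto intro: continuous_on_subset inj_on_subset)
    then have "open (f 1 ` interior K)"
      by (rule invariance_of_domain[OF _ open_interior])
    moreover have "f 1 ` interior K = f 1 ` K \<inter> interior K"
    proof -
      have "f 1 x = x" if "x \<in> frontier K" for x using out front(2) that by blast
      then have "f 1 ` frontier K = frontier K" by simp
      moreover have "f 1 ` K = f 1 ` interior K \<union> f 1 ` frontier K"
        unfolding image_Un[symmetric] front(3)[symmetric] ..
      moreover have "f 1 ` interior K \<subseteq> interior K" by (rule image_subsetI) (rule into)
      ultimately have "f 1 ` K \<inter> interior K = f 1 ` interior K \<union> (frontier K \<inter> interior K)"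
        by (simp add: Int_Un_distrib2 Int_absorb2)
      then show ?thesis by (simp only: front(2) Un_empty_right)
    qed
    moreover have "closed (f 1 ` K)"
      using compact_continuous_image[OF cont compact] by (rule compact_imp_closed)
    ultimately have "openin (top_of_set (interior K)) (f 1 ` interior K)"
      "closedin (top_of_set (interior K)) (f 1 ` interior K)"
      using into by (auto simp: openin_open_eq closedin_closed intro: exI[of _ "f 1 ` K"])
    moreover have "connected (interior K)" by (simp add: convex_connected convex)
    ultimately show ?thesis using interior unfolding connected_clopen by blast
  qed
  have f1: "f 1 x = x + \<eta> x" for x by (simp add: f_def)
  have "f 1 ` K = K"
  proof
    have "f 1 x \<in> K" if "x \<in> K" for x
      using into[of x] out[of x 1] interior_subset[of K] that by (cases "x \<in> interior K") auto
    then show "f 1 ` K \<subseteq> K" by blast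
    have "x \<in> f 1 ` K" if "x \<in> K" for x
    proof (cases "x \<in> interior K")
      case True
      then show ?thesis using onto interior_subset[of K] by blast
    next
      case False
      with that show ?thesis using out[OF False, of 1] by (metis imageI)
    qed
    then show "K \<subseteq> f 1 ` K" by blast
  qed
  moreover have "f 1 = (\<lambda>x. x + \<eta> x)" by (simp add: fun_eq_iff f1)
  ultimately have im: "(\<lambda>x. x + \<eta> x) ` K = K" by (simp only:)
  have "\<forall>x\<in>K. \<forall>y\<in>K. c/2 * norm (x - y) \<le> norm ((x + \<eta> x) - (y + \<eta> y))"
    using low[of 1] by (simp add: f1)
  moreover have "c/2 > 0" using c by simp
  ultimately have low2: "\<exists>c>0. \<forall>x\<in>K. \<forall>y\<in>K. c * norm (x - y) \<le> norm ((x + \<eta> x) - (y + \<eta> y))"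
    by (intro exI[of _ "c/2"] conjI)
  show ?thesis unfolding Om_def mem_Collect_eq by (intro conjI) fact+
qed

lemma Om_nbhd:
  assumes "\<gamma> \<in> Om"
  obtains e where "e > 0" "C1_nbhd \<gamma> e \<subseteq> Om"
proof -
  note Om = assms[unfolded Om_def mem_Collect_eq]
  have "\<exists>c>0. \<forall>x\<in>K. \<forall>y\<in>K. c * norm (x - y) \<le> norm ((x + \<gamma> x) - (y + \<gamma> y))"
    by (rule Om[THEN conjunct2, THEN conjunct2])
  then obtain c where c: "c > 0"
    "\<And>x y. x \<in> K \<Longrightarrow> y \<in> K \<Longrightarrow> c * norm (x - y) \<le> norm ((x + \<gamma> x) - (y + \<gamma> y))"
    by blast
  have "C1_nbhd \<gamma> (c / (2 * CARD('n))) \<subseteq> Om"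
    by (rule subsetI) (rule Om_perturb[OF conjunct1[OF Om] Om[THEN conjunct2, THEN conjunct1] c])
  moreover have "c / (2 * CARD('n)) > 0" using c(1) by simp
  ultimately show thesis using that by blast
qed

lemma Om_E: "\<gamma> \<in> Om \<Longrightarrow> \<gamma> \<in> E"
  by (simp add: Om_def)

lemma openin_Om: "openin T Om"
proof (subst openin_subopen, intro ballI)
  fix \<gamma> assume "\<gamma> \<in> Om"
  from Om_nbhd[OF this] obtain e where "e > 0" "C1_nbhd \<gamma> e \<subseteq> Om" .
  then show "\<exists>S. openin T S \<and> \<gamma> \<in> S \<and> S \<subseteq> Om"
    using openin_C1_nbhd C1_nbhd_self Om_E[OF \<open>\<gamma> \<in> Om\<close>] by (intro exI[of _ "C1_nbhd \<gamma> e"] conjI)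
qed

lemma Om_path:
  assumes "\<gamma> \<in> Om" "\<eta> \<in> E"
  shows "\<forall>\<^sub>F t in at 0. \<gamma> + t *\<^sub>R \<eta> \<in> Om"
proof -
  from Om_nbhd[OF assms(1)] obtain e where e: "e > 0" "C1_nbhd \<gamma> e \<subseteq> Om" .
  from C1_nbhd_path[OF Om_E[OF assms(1)] assms(2) e(1)]
  show ?thesis by (rule eventually_mono) (rule subsetD[OF e(2)])
qed

end

section \<open>Inversion\<close>

lemma has_vector_derivative_transform_eventually_0:
  assumes "(f has_vector_derivative d) (at 0)" "\<forall>\<^sub>F t in at 0. f t = g t" "f 0 = g 0"
  shows "(g has_vector_derivative d) (at (0::real))"
  using assms unfolding has_vector_derivative_def
  by (auto intro: has_derivative_transform_eventually)

text \<open>Convergence of w is enough, because the factor t cancels in the difference quotient at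
  0. This breaks the circle in differentiating the inversion: the moving point need only be known to
  converge.\<close>

lemma has_vector_derivative_scaleR_tendsto:
  fixes w :: "real \<Rightarrow> 'a::real_normed_vector"
  assumes "(w \<longlongrightarrow> l) (at 0)"
  shows "((\<lambda>t. t *\<^sub>R w t) has_vector_derivative l) (at 0)"
proof -
  have "\<forall>\<^sub>F t in at 0. w t = (1 / t) *\<^sub>R (t *\<^sub>R w t)"
    by (simp add: eventually_at_filter)
  with assms have "((\<lambda>t. (1 / t) *\<^sub>R (t *\<^sub>R w t)) \<longlongrightarrow> l) (at 0)"
    by (rule Lim_transform_eventually)
  then have "has_dir_deriv euclidean (\<lambda>t. t *\<^sub>R w t) 1 0 l"
    by (simp add: has_dir_deriv_def)
  then show ?thesis by (simp add: has_dir_deriv_euclidean)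
qed

lemma matrix_inv_inverse:
  "invertible A \<Longrightarrow> A ** matrix_inv A = mat 1 \<and> matrix_inv A ** A = mat 1"
  unfolding matrix_inv_def invertible_def by (rule someI_ex)

context convex_body
begin

definition F :: "(real ^ 'n \<Rightarrow> real ^ 'n) \<Rightarrow> real ^ 'n \<Rightarrow> real ^ 'n"
  where "F \<gamma> = inv_into K (\<lambda>x. x + \<gamma> x)"

definition Jac :: "(real ^ 'n \<Rightarrow> real ^ 'n) \<Rightarrow> real ^ 'n \<Rightarrow> real ^ 'n ^ 'n"
  where "Jac \<gamma> x = (\<chi> i j. (if i = j then 1 else 0) + partial j \<gamma> x $ i)"

lemma Jac_mult: "Jac \<gamma> x *v h = h + (\<Sum>j\<in>UNIV. (h $ j) *\<^sub>R partial j \<gamma> x)"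
proof -
  have "(\<Sum>j\<in>UNIV. ((if i = j then 1 else 0) + partial j \<gamma> x $ i) * h $ j)
      = h $ i + (\<Sum>j\<in>UNIV. h $ j * partial j \<gamma> x $ i)" for i
  proof -
    have "(\<Sum>j\<in>UNIV. (if i = j then 1 else 0) * h $ j) = h $ i"
      by (simp add: if_distrib[of "\<lambda>c. c * _"] cong: if_cong)
    then show ?thesis unfolding distrib_right sum.distrib by (simp add: mult.commute)
  qed
  then show ?thesis
    by (simp add: vec_eq_iff matrix_vector_mult_def Jac_def)
qed

lemma diffeo_has_derivative:
  assumes "Cr \<gamma>" "x \<in> interior K"
  shows "((\<lambda>x. x + \<gamma> x) has_derivative (\<lambda>h. Jac \<gamma> x *v h)) (at x)"
  unfolding Jac_mult by (intro has_derivative_add has_derivative_ident has_derivative_partials assms)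

text \<open>At interior points the bound is the limit of the bounds for difference quotients. Both
  sides are continuous on K, so it persists at frontier points, where it keeps the Jacobian
  invertible.\<close>

lemma Jac_lower_bound:
  assumes "Cr \<gamma>"
    and low: "\<And>x y. x \<in> K \<Longrightarrow> y \<in> K \<Longrightarrow> c * norm (x - y) \<le> norm ((x + \<gamma> x) - (y + \<gamma> y))"
    and "x \<in> K"
  shows "c * norm h \<le> norm (Jac \<gamma> x *v h)"
proof -
  have int: "c * norm h - norm (Jac \<gamma> x *v h) \<le> 0" if x: "x \<in> interior K" for x
  proof -
    let ?\<phi> = "\<lambda>x. x + \<gamma> x"
    have xK: "x \<in> K" using x interior_subset by blast
    have "((\<lambda>t. x + t *\<^sub>R h) has_vector_derivative h) (at 0)" by (auto intro!: derivative_eq_intros)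
    moreover have "(?\<phi> has_derivative (\<lambda>h. Jac \<gamma> x *v h)) (at (x + 0 *\<^sub>R h))"
      using diffeo_has_derivative[OF assms(1) x] by simp
    ultimately have "((\<lambda>t. ?\<phi> (x + t *\<^sub>R h)) has_vector_derivative Jac \<gamma> x *v h) (at 0)"
      using vector_derivative_diff_chain_within[of "\<lambda>t. x + t *\<^sub>R h" h 0 UNIV ?\<phi>]
      by (auto simp: o_def intro: has_derivative_at_withinI)
    then have "has_dir_deriv euclidean ?\<phi> h x (Jac \<gamma> x *v h)"
      unfolding has_dir_deriv_euclidean .
    then have lim: "((\<lambda>t. norm ((1 / t) *\<^sub>R (?\<phi> (x + t *\<^sub>R h) - ?\<phi> x))) \<longlongrightarrow> norm (Jac \<gamma> x *v h)) (at 0)"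
      unfolding has_dir_deriv_def limitin_canonical_iff by (rule tendsto_norm)
    have "\<forall>\<^sub>F t in at 0. x + t *\<^sub>R h \<in> interior K \<and> t \<noteq> 0"
      using interior_path[OF x] by (simp add: eventually_conj_iff eventually_at_filter)
    then have "\<forall>\<^sub>F t in at 0. c * norm h \<le> norm ((1 / t) *\<^sub>R (?\<phi> (x + t *\<^sub>R h) - ?\<phi> x))"
    proof (rule eventually_mono)
      fix t assume t: "x + t *\<^sub>R h \<in> interior K \<and> t \<noteq> 0"
      then have "x + t *\<^sub>R h \<in> K" using interior_subset by blast
      define u where "u = ?\<phi> (x + t *\<^sub>R h) - ?\<phi> x"
      from low[OF \<open>x + t *\<^sub>R h \<in> K\<close> xK] have "c * (\<bar>t\<bar> * norm h) \<le> norm u" by (simp add: u_def)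
      then have "c * norm h \<le> norm ((1 / t) *\<^sub>R u)"
        using t by (simp add: field_simps)
      then show "c * norm h \<le> norm ((1 / t) *\<^sub>R (?\<phi> (x + t *\<^sub>R h) - ?\<phi> x))"
        unfolding u_def .
    qed
    from tendsto_lowerbound[OF lim this] show ?thesis by simp
  qed
  have "continuous_on K (\<lambda>x. c * norm h - norm (Jac \<gamma> x *v h))"
    unfolding Jac_mult by (intro continuous_intros continuous_on_partial assms)
  from continuous_le_on_closure[of "interior K", unfolded closure_interior_K, OF this assms(3) int]
  show ?thesis by simp
qed

lemma OmE:
  assumes "\<gamma> \<in> Om"
  obtains c where "c > 0"
    "\<And>x y. x \<in> K \<Longrightarrow> y \<in> K \<Longrightarrow> c * norm (x - y) \<le> norm ((x + \<gamma> x) - (y + \<gamma> y))"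
proof -
  have "\<exists>c>0. \<forall>x\<in>K. \<forall>y\<in>K. c * norm (x - y) \<le> norm ((x + \<gamma> x) - (y + \<gamma> y))"
    by (rule assms[unfolded Om_def mem_Collect_eq, THEN conjunct2, THEN conjunct2])
  then show thesis using that by blast
qed

lemma Om_image: "\<gamma> \<in> Om \<Longrightarrow> (\<lambda>x. x + \<gamma> x) ` K = K"
  unfolding Om_def mem_Collect_eq by (elim conjE)

lemma det_Jac:
  assumes "\<gamma> \<in> Om" "x \<in> K"
  shows "det (Jac \<gamma> x) \<noteq> 0"
proof -
  obtain c where c: "c > 0"
    "\<And>x y. x \<in> K \<Longrightarrow> y \<in> K \<Longrightarrow> c * norm (x - y) \<le> norm ((x + \<gamma> x) - (y + \<gamma> y))"
    using OmE[OF assms(1)] by blast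
  have "h = 0" if "Jac \<gamma> x *v h = 0" for h
  proof -
    have "c * norm h \<le> 0"
      using Jac_lower_bound[OF E_Cr[OF Om_E[OF assms(1)]] c(2) assms(2), of h] that by simp
    then show ?thesis using c(1) by (simp add: mult_le_0_iff)
  qed
  then have "\<exists>B. B ** Jac \<gamma> x = mat 1" by (simp add: matrix_left_invertible_ker)
  then show ?thesis
    by (metis invertible_det_nz invertible_left_inverse)
qed

section \<open>The inverse map and its joint continuity\<close>

lemma F_in: "\<gamma> \<in> Om \<Longrightarrow> y \<in> K \<Longrightarrow> F \<gamma> y \<in> K"
  unfolding F_def by (rule inv_into_into) (simp add: Om_image)

lemma F_right: "\<gamma> \<in> Om \<Longrightarrow> y \<in> K \<Longrightarrow> F \<gamma> y + \<gamma> (F \<gamma> y) = y"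
  using f_inv_into_f[of y "\<lambda>x. x + \<gamma> x" K] by (simp add: F_def Om_image)

lemma Om_inj: "\<gamma> \<in> Om \<Longrightarrow> inj_on (\<lambda>x. x + \<gamma> x) K"
proof (rule inj_onI)
  fix x y assume "\<gamma> \<in> Om" and xy: "x \<in> K" "y \<in> K" "x + \<gamma> x = y + \<gamma> y"
  obtain c where c: "c > 0"
    "\<And>x y. x \<in> K \<Longrightarrow> y \<in> K \<Longrightarrow> c * norm (x - y) \<le> norm ((x + \<gamma> x) - (y + \<gamma> y))"
    using OmE[OF \<open>\<gamma> \<in> Om\<close>] by blast
  from c(2)[OF xy(1,2)] c(1) xy(3) show "x = y" by (simp add: mult_le_0_iff)
qed

lemma F_left: "\<gamma> \<in> Om \<Longrightarrow> x \<in> K \<Longrightarrow> F \<gamma> (x + \<gamma> x) = x"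
  unfolding F_def by (rule inv_into_f_f[OF Om_inj])

text \<open>Off the interior \<gamma> vanishes, so a point there would be its own image and could
  not be sent to an interior point.\<close>

lemma F_interior:
  assumes "\<gamma> \<in> Om" "y \<in> interior K"
  shows "F \<gamma> y \<in> interior K"
proof (rule ccontr)
  assume *: "F \<gamma> y \<notin> interior K"
  then have "\<gamma> (F \<gamma> y) = 0" using Om_E[OF assms(1)] by (simp add: E_iff)
  moreover have "y \<in> K" using assms(2) interior_subset by blast
  ultimately have "F \<gamma> y = y" using F_right[OF assms(1), of y] by simp
  with * assms(2) show False by simp
qed

text \<open>The point x = \<open>F \<eta> z\<close> satisfies x + \<gamma> x = z - (\<eta> x -
  \<gamma> x); comparing with y = \<open>F \<gamma> y + \<gamma> (F \<gamma> y)\<close> and using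
  the lower bound for \<gamma> alone gives the claim. It yields both joint continuity and the
  Lipschitz estimate along lines.\<close>

lemma F_estimate:
  assumes "\<gamma> \<in> Om" "\<eta> \<in> Om" "y \<in> K" "z \<in> K"
    and low: "\<And>x y. x \<in> K \<Longrightarrow> y \<in> K \<Longrightarrow> c * norm (x - y) \<le> norm ((x + \<gamma> x) - (y + \<gamma> y))"
  shows "c * norm (F \<eta> z - F \<gamma> y) \<le> norm (z - y) + norm (\<eta> (F \<eta> z) - \<gamma> (F \<eta> z))"
proof -
  have eq: "(F \<eta> z + \<gamma> (F \<eta> z)) - (F \<gamma> y + \<gamma> (F \<gamma> y)) = (z - y) - (\<eta> (F \<eta> z) - \<gamma> (F \<eta> z))"
    using F_right[OF assms(2,4)] F_right[OF assms(1,3)] by (simp add: algebra_simps)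
  show ?thesis
    using low[OF F_in[OF assms(2,4)] F_in[OF assms(1,3)]]
      norm_triangle_ineq4[of "z - y" "\<eta> (F \<eta> z) - \<gamma> (F \<eta> z)"]
    unfolding eq by linarith
qed

lemma continuous_map_eval: "continuous_map (prod_topology T (top_of_set K)) euclidean (\<lambda>p. (fst p) (snd p))"
  by (rule continuous_map_eq[OF continuous_map_jet[of 0 "\<lambda>_. 0"]])
    (auto simp: zero_enat_def[symmetric] jet_0 E_Cr)

lemma openin_C0_nbhd:
  assumes "\<gamma> \<in> E"
  shows "openin T {\<eta> \<in> E. \<forall>x\<in>K. norm (\<eta> x - \<gamma> x) < e}"
proof -
  have "continuous_map (top_of_set K) euclidean \<gamma>"
    using E_Cr[OF assms] by (simp add: Cr_on_def)
  then have "continuous_map (prod_topology T (top_of_set K)) euclidean (\<lambda>p. \<gamma> (snd p))"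
    by (rule continuous_map_compose[OF continuous_map_snd, unfolded o_def])
  then have "continuous_map (prod_topology T (top_of_set K)) euclideanreal (\<lambda>p. norm ((fst p) (snd p) - \<gamma> (snd p)))"
    by (intro continuous_map_norm continuous_map_diff continuous_map_eval)
  from openin_forall_less_compact[OF compact this] show ?thesis by simp
qed

lemma continuous_map_F:
  "continuous_map (prod_topology (subtopology T Om) (top_of_set K)) (top_of_set K) (\<lambda>p. F (fst p) (snd p))"
proof -
  let ?X = "prod_topology (subtopology T Om) (top_of_set K)"
  have "continuous_map ?X euclidean (\<lambda>p. F (fst p) (snd p))"
    unfolding continuous_map_eq_topcontinuous_at topcontinuous_at_def
  proof (intro ballI conjI allI impI)
    fix p V assume p: "p \<in> topspace ?X" and V: "openin euclidean V \<and> F (fst p) (snd p) \<in> V"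
    define \<gamma> y where "\<gamma> = fst p" "y = snd p"
    have g: "\<gamma> \<in> Om" and y: "y \<in> K" using p by (auto simp: \<gamma>_y_def)
    obtain e where e: "e > 0" "ball (F \<gamma> y) e \<subseteq> V"
      using V by (auto simp: \<gamma>_y_def open_contains_ball)
    obtain c where c: "c > 0"
      "\<And>x y. x \<in> K \<Longrightarrow> y \<in> K \<Longrightarrow> c * norm (x - y) \<le> norm ((x + \<gamma> x) - (y + \<gamma> y))"
      using OmE[OF g] by blast
    \<comment> \<open>The two terms of \<open>F_estimate\<close> contribute less than half of c * e
      each.\<close>
    let ?d = "c * e / 2"
    let ?N = "{\<eta> \<in> E. \<forall>x\<in>K. norm (\<eta> x - \<gamma> x) < ?d}"
    let ?W = "(Om \<inter> ?N) \<times> (K \<inter> ball y ?d)"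
    have d: "?d > 0" using c e by simp
    have "openin (subtopology T Om) (Om \<inter> ?N)"
      using openin_C0_nbhd[OF Om_E[OF g], of ?d] by (auto simp: openin_subtopology Int_commute)
    then have "openin ?X ?W"
      by (simp add: openin_prod_Times_iff openin_open_Int)
    moreover have "p \<in> ?W"
      using g y d Om_E[OF g] by (simp add: \<gamma>_y_def mem_Times_iff)
    moreover have "F (fst q) (snd q) \<in> V" if "q \<in> ?W" for q
    proof -
      define \<eta> z where "\<eta> = fst q" "z = snd q"
      have q: "\<eta> \<in> Om" "z \<in> K" "norm (z - y) < ?d" "\<And>x. x \<in> K \<Longrightarrow> norm (\<eta> x - \<gamma> x) < ?d"
        using that by (auto simp: \<eta>_z_def dist_norm norm_minus_commute)
      have "c * norm (F \<eta> z - F \<gamma> y) \<le> norm (z - y) + norm (\<eta> (F \<eta> z) - \<gamma> (F \<eta> z))"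
        by (rule F_estimate[OF g q(1) y q(2) c(2)])
      also have "\<dots> < c * e" using q(3) q(4)[OF F_in[OF q(1,2)]] by simp
      finally have "norm (F \<eta> z - F \<gamma> y) < e" using c(1) by simp
      then show ?thesis using e(2) by (auto simp: \<eta>_z_def dist_norm norm_minus_commute subset_iff)
    qed
    ultimately show "\<exists>U. openin ?X U \<and> p \<in> U \<and> (\<forall>y\<in>U. F (fst y) (snd y) \<in> V)"
      by blast
  qed auto
  then show ?thesis
    by (auto simp: continuous_map_in_subtopology F_in)
qed

lemma continuous_on_F: "\<gamma> \<in> Om \<Longrightarrow> continuous_on K (F \<gamma>)"
proof -
  assume g: "\<gamma> \<in> Om"
  have "continuous_map (top_of_set K) (prod_topology (subtopology T Om) (top_of_set K)) (\<lambda>y. (\<gamma>, y))"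
    using g Om_E[OF g] by (intro continuous_intros) (auto simp: id_def[symmetric])
  from continuous_map_compose[OF this continuous_map_F]
  show ?thesis by (simp add: o_def continuous_map_in_subtopology)
qed

text \<open>Continuity of the inverse and invertibility of the Jacobian are already available, so
  the elementary rule for differentiating an inverse applies.\<close>

lemma F_has_derivative:
  assumes "\<gamma> \<in> Om" "y \<in> interior K"
  shows "(F \<gamma> has_derivative (\<lambda>w. matrix_inv (Jac \<gamma> (F \<gamma> y)) *v w)) (at y)"
proof (rule has_derivative_inverse_basic)
  let ?J = "Jac \<gamma> (F \<gamma> y)"
  show "((\<lambda>x. x + \<gamma> x) has_derivative (\<lambda>h. ?J *v h)) (at (F \<gamma> y))"
    by (rule diffeo_has_derivative[OF E_Cr[OF Om_E[OF assms(1)]] F_interior[OF assms]])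
  have "y \<in> K" using assms(2) interior_subset by blast
  then have "invertible ?J"
    using det_Jac[OF assms(1) F_in[OF assms(1)]] by (simp add: invertible_det_nz)
  then have "matrix_inv ?J ** ?J = mat 1" by (simp add: matrix_inv_inverse)
  then show "(*v) (matrix_inv ?J) \<circ> (*v) ?J = id"
    by (simp add: fun_eq_iff matrix_vector_mul_assoc)
  show "continuous (at y) (F \<gamma>)"
    by (rule continuous_on_interior[OF continuous_on_F[OF assms(1)] assms(2)])
  show "F \<gamma> z + \<gamma> (F \<gamma> z) = z" if "z \<in> interior K" for z
    using F_right[OF assms(1)] that interior_subset by blast
qed (use assms(2) in \<open>auto intro: matrix_vector_mul_bounded_linear\<close>)

text \<open>
  Along a line in \<^term>\<open>Om \<times> interior K\<close>, the path \<open>x t = F (\<gamma> + t \<eta>) (y + t v)\<close>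
  satisfies \<open>x t = F \<gamma> (y + t (v - \<eta> (x t)))\<close>.
\<close>

context
  fixes \<gamma> \<eta> :: "real ^ 'n \<Rightarrow> real ^ 'n" and y v :: "real ^ 'n"
  assumes \<gamma>: "\<gamma> \<in> Om" and \<eta>: "\<eta> \<in> E" and y: "y \<in> interior K"
begin

lemma eventually_line: "\<forall>\<^sub>F t in at 0. \<gamma> + t *\<^sub>R \<eta> \<in> Om \<and> y + t *\<^sub>R v \<in> interior K"
  using Om_path[OF \<gamma> \<eta>] interior_path[OF y] by (rule eventually_conj)

lemma F_line_in: "\<forall>\<^sub>F t in at 0. F (\<gamma> + t *\<^sub>R \<eta>) (y + t *\<^sub>R v) \<in> interior K"
  using eventually_line by (rule eventually_mono) (use F_interior in blast)

text \<open>Boundedness of \<eta> on K turns \<open>F_estimate\<close> into a bound linear in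
  |t|.\<close>

lemma F_line_tendsto: "((\<lambda>t. F (\<gamma> + t *\<^sub>R \<eta>) (y + t *\<^sub>R v)) \<longlongrightarrow> F \<gamma> y) (at 0)"
proof -
  let ?x = "\<lambda>t. F (\<gamma> + t *\<^sub>R \<eta>) (y + t *\<^sub>R v)"
  obtain c where c: "c > 0"
    "\<And>x y. x \<in> K \<Longrightarrow> y \<in> K \<Longrightarrow> c * norm (x - y) \<le> norm ((x + \<gamma> x) - (y + \<gamma> y))"
    using OmE[OF \<gamma>] by blast
  have "continuous_on K \<eta>" using E_Cr[OF \<eta>] by (simp add: Cr_on_def)
  from compact_imp_bounded[OF compact_continuous_image[OF this compact]]
  obtain B where B: "\<And>x. x \<in> K \<Longrightarrow> norm (\<eta> x) \<le> B" by (auto simp: bounded_iff)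
  have "\<forall>\<^sub>F t in at 0. norm (?x t - F \<gamma> y) \<le> \<bar>t\<bar> * ((norm v + B) / c)"
    using eventually_line
  proof (rule eventually_mono)
    fix t assume t: "\<gamma> + t *\<^sub>R \<eta> \<in> Om \<and> y + t *\<^sub>R v \<in> interior K"
    have K: "y \<in> K" "y + t *\<^sub>R v \<in> K" using y t interior_subset by blast+
    have x: "?x t \<in> K" using F_in t K by blast
    have "c * norm (?x t - F \<gamma> y) \<le> norm (y + t *\<^sub>R v - y)
        + norm ((\<gamma> + t *\<^sub>R \<eta>) (?x t) - \<gamma> (?x t))"
      using F_estimate[OF \<gamma> _ K c(2)] t by blast
    also have "\<dots> = \<bar>t\<bar> * norm v + \<bar>t\<bar> * norm (\<eta> (?x t))" by simp
    also have "\<dots> \<le> \<bar>t\<bar> * (norm v + B)"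
      using mult_left_mono[OF B[OF x], of "\<bar>t\<bar>"] by (simp add: algebra_simps)
    finally show "norm (?x t - F \<gamma> y) \<le> \<bar>t\<bar> * ((norm v + B) / c)"
      using c(1) by (simp add: field_simps)
  qed
  moreover have "((\<lambda>t. \<bar>t\<bar> * ((norm v + B) / c)) \<longlongrightarrow> \<bar>0\<bar> * ((norm v + B) / c)) (at 0)"
    by (intro tendsto_intros)
  then have "((\<lambda>t. \<bar>t\<bar> * ((norm v + B) / c)) \<longlongrightarrow> 0) (at 0)" by simp
  ultimately have "((\<lambda>t. ?x t - F \<gamma> y) \<longlongrightarrow> 0) (at 0)" by (rule Lim_null_comparison)
  then show ?thesis by (simp add: LIM_zero_iff)
qed

lemma tendsto_along_F_line:
  assumes "continuous_on K f"
  shows "((\<lambda>t. f (F (\<gamma> + t *\<^sub>R \<eta>) (y + t *\<^sub>R v))) \<longlongrightarrow> f (F \<gamma> y)) (at 0)"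
  by (rule isCont_tendsto_compose[OF continuous_on_interior[OF assms F_interior[OF \<gamma> y]] F_line_tendsto])

text \<open>The argument y + t (v - \<eta> (x t)) is differentiable at 0 by
  \<open>has_vector_derivative_scaleR_tendsto\<close>, and the chain rule is applied to the fixed
  map \<open>F \<gamma>\<close>. Cramer's rule replaces the inverse matrix by a quotient of
  determinants in the entries of jets, the form that the later algebra can hold.\<close>

lemma F_line_has_vector_derivative:
  shows "((\<lambda>t. F (\<gamma> + t *\<^sub>R \<eta>) (y + t *\<^sub>R v)) has_vector_derivative
    (\<chi> k. det (\<chi> i j. if j = k then (v - \<eta> (F \<gamma> y)) $ i else Jac \<gamma> (F \<gamma> y) $ i $ j) / det (Jac \<gamma> (F \<gamma> y)))) (at 0)"
proof -
  let ?x = "\<lambda>t. F (\<gamma> + t *\<^sub>R \<eta>) (y + t *\<^sub>R v)" and ?J = "Jac \<gamma> (F \<gamma> y)"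
  let ?u = "\<lambda>t. y + t *\<^sub>R (v - \<eta> (?x t))" and ?w = "v - \<eta> (F \<gamma> y)"
  have yK: "y \<in> K" using y interior_subset by blast
  have "continuous_on K \<eta>" using E_Cr[OF \<eta>] by (simp add: Cr_on_def)
  then have "((\<lambda>t. v - \<eta> (?x t)) \<longlongrightarrow> ?w) (at 0)"
    by (intro tendsto_diff tendsto_const tendsto_along_F_line)
  from has_vector_derivative_add[OF has_vector_derivative_const has_vector_derivative_scaleR_tendsto[OF this]]
  have u: "(?u has_vector_derivative ?w) (at 0)" by simp
  have "(F \<gamma> has_derivative (\<lambda>w. matrix_inv ?J *v w)) (at (?u 0))"
    using F_has_derivative[OF \<gamma> y] by simp
  from vector_derivative_diff_chain_within[OF u[THEN has_vector_derivative_at_within, of UNIV]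
      has_derivative_at_withinI[OF this]]
  have "((\<lambda>t. F \<gamma> (?u t)) has_vector_derivative matrix_inv ?J *v ?w) (at 0)"
    by (simp only: o_def)
  then have "(?x has_vector_derivative matrix_inv ?J *v ?w) (at 0)"
  proof (rule has_vector_derivative_transform_eventually_0)
    show "\<forall>\<^sub>F t in at 0. F \<gamma> (?u t) = ?x t"
      using eventually_line
    proof (rule eventually_mono)
      fix t assume t: "\<gamma> + t *\<^sub>R \<eta> \<in> Om \<and> y + t *\<^sub>R v \<in> interior K"
      then have K: "y + t *\<^sub>R v \<in> K" using interior_subset by blast
      have "?x t + (\<gamma> + t *\<^sub>R \<eta>) (?x t) = y + t *\<^sub>R v"
        using F_right[OF _ K] t by blast
      then have "?u t = ?x t + \<gamma> (?x t)" by (simp add: algebra_simps)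
      then show "F \<gamma> (?u t) = ?x t" using F_left[OF \<gamma>] F_in[OF _ K] t by simp
    qed
  qed simp
  moreover have "matrix_inv ?J *v ?w =
      (\<chi> k. det (\<chi> i j. if j = k then ?w $ i else ?J $ i $ j) / det ?J)"
  proof -
    have d: "det ?J \<noteq> 0" by (rule det_Jac[OF \<gamma> F_in[OF \<gamma> yK]])
    then have "?J ** matrix_inv ?J = mat 1" by (simp add: matrix_inv_inverse flip: invertible_det_nz)
    then have "?J *v (matrix_inv ?J *v ?w) = ?w" by (simp add: matrix_vector_mul_assoc)
    then show ?thesis by (subst (asm) cramer[OF d])
  qed
  ultimately show ?thesis by simp
qed

lemma jet_F_line_has_vector_derivative:
  assumes f: "Cr f" and k: "enat (Suc k) \<le> r"
    and x': "((\<lambda>t. F (\<gamma> + t *\<^sub>R \<eta>) (y + t *\<^sub>R v)) has_vector_derivative x') (at 0)"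
  shows "((\<lambda>t. jet K k f (F (\<gamma> + t *\<^sub>R \<eta>) (y + t *\<^sub>R v)) ws) has_vector_derivative
      (\<Sum>j\<in>UNIV. (x' $ j) *\<^sub>R jet K (Suc k) f (F \<gamma> y) (ws(Suc k := axis j 1)))) (at 0)"
proof -
  let ?x = "\<lambda>t. F (\<gamma> + t *\<^sub>R \<eta>) (y + t *\<^sub>R v)"
  have "((\<lambda>z. jet K k f z ws) has_derivative
      (\<lambda>h. \<Sum>j\<in>UNIV. (h $ j) *\<^sub>R jet K (Suc k) f (F \<gamma> y) (ws(Suc k := axis j 1)))) (at (?x 0))"
    using jet_has_derivative[OF f k F_interior[OF \<gamma> y]] by simp
  from vector_derivative_diff_chain_within[OF x'[THEN has_vector_derivative_at_within, of UNIV]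
      has_derivative_at_withinI[OF this]]
  show ?thesis by (simp only: o_def)
qed

text \<open>Now the function moves along with the point. Jets are linear in the function, and the
  extra term t times the jet of \<eta> needs no derivative of that jet, so \<eta> enters only with
  order k.\<close>

lemma jet_line_F_line_has_vector_derivative:
  assumes k: "enat (Suc k) \<le> r"
    and x': "((\<lambda>t. F (\<gamma> + t *\<^sub>R \<eta>) (y + t *\<^sub>R v)) has_vector_derivative x') (at 0)"
  shows "((\<lambda>t. jet K k (\<gamma> + t *\<^sub>R \<eta>) (F (\<gamma> + t *\<^sub>R \<eta>) (y + t *\<^sub>R v)) ws) has_vector_derivative
      (\<Sum>j\<in>UNIV. (x' $ j) *\<^sub>R jet K (Suc k) \<gamma> (F \<gamma> y) (ws(Suc k := axis j 1)))
        + jet K k \<eta> (F \<gamma> y) ws) (at 0)"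
proof -
  let ?x = "\<lambda>t. F (\<gamma> + t *\<^sub>R \<eta>) (y + t *\<^sub>R v)"
  have k': "enat k \<le> r" using k by (metis Suc_ile_eq order_less_imp_le)
  have "((\<lambda>t. t *\<^sub>R jet K k \<eta> (?x t) ws) has_vector_derivative jet K k \<eta> (F \<gamma> y) ws) (at 0)"
    by (rule has_vector_derivative_scaleR_tendsto[OF tendsto_along_F_line[OF continuous_on_jet[OF E_Cr[OF \<eta>] k']]])
  from has_vector_derivative_add[OF jet_F_line_has_vector_derivative[OF E_Cr[OF Om_E[OF \<gamma>]] k x'] this]
  show ?thesis
  proof (rule has_vector_derivative_transform_eventually_0)
    show "\<forall>\<^sub>F t in at 0. jet K k \<gamma> (?x t) ws + t *\<^sub>R jet K k \<eta> (?x t) ws = jet K k (\<gamma> + t *\<^sub>R \<eta>) (?x t) ws"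
      using F_line_in
    proof (rule eventually_mono)
      fix t assume "?x t \<in> interior K"
      then have "?x t \<in> K" using interior_subset by blast
      from jet_path[OF Om_E[OF \<gamma>] \<eta> k' this]
      show "jet K k \<gamma> (?x t) ws + t *\<^sub>R jet K k \<eta> (?x t) ws = jet K k (\<gamma> + t *\<^sub>R \<eta>) (?x t) ws"
        by simp
    qed
  qed simp
qed

end

end

section \<open>An algebra of functions containing all derivatives of the inversion\<close>

context convex_body
begin

text \<open>
  Here \<open>m\<close> bounds the order of the jets and \<open>k\<close> is the number of directions. All jets are taken
  at the point \<^term>\<open>F \<gamma> y\<close>, so that a derivative raises both by one.
\<close>

inductive jet_poly :: "nat \<Rightarrow> nat \<Rightarrow> ((real ^ 'n \<Rightarrow> real ^ 'n) \<times> (real ^ 'n) \<Rightarrow>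
    (nat \<Rightarrow> (real ^ 'n \<Rightarrow> real ^ 'n) \<times> (real ^ 'n)) \<Rightarrow> real) \<Rightarrow> bool" where
  const: "jet_poly m k (\<lambda>p ys. c)"
| base: "jet_poly m k (\<lambda>p ys. F (fst p) (snd p) $ i)"
| base_jet: "a \<le> m \<Longrightarrow> jet_poly m k (\<lambda>p ys. jet K a (fst p) (F (fst p) (snd p)) ws $ i)"
| dir_vec: "l \<in> {1..k} \<Longrightarrow> jet_poly m k (\<lambda>p ys. snd (ys l) $ i)"
| dir_jet: "a \<le> m \<Longrightarrow> l \<in> {1..k} \<Longrightarrow>
    jet_poly m k (\<lambda>p ys. jet K a (fst (ys l)) (F (fst p) (snd p)) ws $ i)"
| add: "jet_poly m k \<Phi> \<Longrightarrow> jet_poly m k \<Psi> \<Longrightarrow> jet_poly m k (\<lambda>p ys. \<Phi> p ys + \<Psi> p ys)"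
| mult: "jet_poly m k \<Phi> \<Longrightarrow> jet_poly m k \<Psi> \<Longrightarrow> jet_poly m k (\<lambda>p ys. \<Phi> p ys * \<Psi> p ys)"
| inverse: "jet_poly m k \<Phi> \<Longrightarrow>
    (\<And>p ys. p \<in> Om \<times> K \<Longrightarrow> ys \<in> {1..k} \<rightarrow> E \<times> UNIV \<Longrightarrow> \<Phi> p ys \<noteq> 0) \<Longrightarrow>
    jet_poly m k (\<lambda>p ys. inverse (\<Phi> p ys))"

lemma jet_poly_mono: "jet_poly m k \<Phi> \<Longrightarrow> m \<le> m' \<Longrightarrow> k \<le> k' \<Longrightarrow> jet_poly m' k' \<Phi>"
proof (induction rule: jet_poly.induct)
  case (inverse m k \<Phi>)
  show ?case
  proof (rule jet_poly.inverse)
    fix p ys assume "p \<in> Om \<times> K" "ys \<in> {1..k'} \<rightarrow> E \<times> (UNIV :: (real ^ 'n) set)"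
    then show "\<Phi> p ys \<noteq> 0" using inverse.prems by (intro inverse.hyps) (auto simp: Pi_iff)
  qed (use inverse in blast)
qed (auto intro: jet_poly.intros)

text \<open>Used to pass between a tuple and its restriction to \<open>{1..k}\<close>, which product
  topologies demand.\<close>

lemma jet_poly_cong:
  "jet_poly m k \<Phi> \<Longrightarrow> (\<And>i. i \<in> {1..k} \<Longrightarrow> ys i = zs i) \<Longrightarrow> \<Phi> p ys = \<Phi> p zs"
  by (induction rule: jet_poly.induct) simp_all

lemma jet_poly_minus: "jet_poly m k \<Phi> \<Longrightarrow> jet_poly m k (\<lambda>p ys. - \<Phi> p ys)"
  using jet_poly.mult[OF jet_poly.const[of m k "-1"]] by simp

lemma jet_poly_sum:
  "(\<And>i. i \<in> A \<Longrightarrow> jet_poly m k (\<Phi> i)) \<Longrightarrow> jet_poly m k (\<lambda>p ys. \<Sum>i\<in>A. \<Phi> i p ys)"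
  by (induction A rule: infinite_finite_induct) (auto intro: jet_poly.const jet_poly.add)

lemma jet_poly_prod:
  "(\<And>i. i \<in> A \<Longrightarrow> jet_poly m k (\<Phi> i)) \<Longrightarrow> jet_poly m k (\<lambda>p ys. \<Prod>i\<in>A. \<Phi> i p ys)"
  by (induction A rule: infinite_finite_induct) (auto intro: jet_poly.const jet_poly.mult)

lemma jet_poly_det:
  fixes A :: "_ \<Rightarrow> _ \<Rightarrow> real ^ 'n ^ 'n"
  assumes "\<And>i j. jet_poly m k (\<lambda>p ys. A p ys $ i $ j)"
  shows "jet_poly m k (\<lambda>p ys. det (A p ys))"
  unfolding det_def by (intro jet_poly_sum jet_poly.mult jet_poly.const jet_poly_prod assms)

lemma jet_poly_Jac: "jet_poly (Suc m) k (\<lambda>p ys. Jac (fst p) (F (fst p) (snd p)) $ i $ j)"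
  unfolding Jac_def partial_def vec_lambda_beta
  by (intro jet_poly.add jet_poly.const jet_poly.base_jet) simp

text \<open>A jet of order 0 stands for \<open>\<eta> x\<close>, because only jets are generators of \<^const>\<open>jet_poly\<close>.\<close>

definition velocity :: "nat \<Rightarrow> 'n \<Rightarrow> (real ^ 'n \<Rightarrow> real ^ 'n) \<times> (real ^ 'n) \<Rightarrow>
    (nat \<Rightarrow> (real ^ 'n \<Rightarrow> real ^ 'n) \<times> (real ^ 'n)) \<Rightarrow> real"
  where "velocity l k p ys =
    (let x = F (fst p) (snd p); w = snd (ys l) - jet K 0 (fst (ys l)) x (\<lambda>_. 0); J = Jac (fst p) x in
      det (\<chi> i j. if j = k then w $ i else J $ i $ j) * inverse (det J))"

lemma jet_poly_velocity:
  assumes "l \<in> {1..k}"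
  shows "jet_poly (Suc m) k (velocity l i)"
proof -
  let ?x = "\<lambda>p. F (fst p) (snd p)"
  have "jet_poly (Suc m) k (\<lambda>p ys. (snd (ys l) - jet K 0 (fst (ys l)) (?x p) (\<lambda>_. 0)) $ a)" for a
    unfolding vector_minus_component unfolding diff_conv_add_uminus
    by (intro jet_poly.add jet_poly_minus jet_poly.dir_vec jet_poly.dir_jet assms) simp
  then have "jet_poly (Suc m) k (\<lambda>p ys. (\<chi> a b. if b = i
      then (snd (ys l) - jet K 0 (fst (ys l)) (?x p) (\<lambda>_. 0)) $ a else Jac (fst p) (?x p) $ a $ b) $ c $ d)" for c d
    by (cases "d = i") (simp_all add: jet_poly_Jac del: vector_minus_component)
  then have "jet_poly (Suc m) k (\<lambda>p ys. det (\<chi> a b. if b = i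
      then (snd (ys l) - jet K 0 (fst (ys l)) (?x p) (\<lambda>_. 0)) $ a else Jac (fst p) (?x p) $ a $ b))"
    by (rule jet_poly_det)
  \<comment> \<open>The side condition of the rule for inverses is \<open>det_Jac\<close>, valid on
    all of \<open>Om \<times> K\<close>.\<close>
  moreover have "jet_poly (Suc m) k (\<lambda>p ys. inverse (det (Jac (fst p) (?x p))))"
    by (intro jet_poly.inverse jet_poly_det jet_poly_Jac) (use det_Jac F_in in force)
  ultimately have "jet_poly (Suc m) k (\<lambda>p ys. velocity l i p ys)"
    unfolding velocity_def Let_def by (rule jet_poly.mult)
  then show ?thesis .
qed

lemma F_velocity:
  assumes "\<gamma> \<in> Om" "y \<in> interior K" "ys l \<in> E \<times> UNIV"
  shows "((\<lambda>t. F (\<gamma> + t *\<^sub>R fst (ys l)) (y + t *\<^sub>R snd (ys l))) has_vector_derivative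
    (\<chi> k. velocity l k (\<gamma>, y) ys)) (at 0)"
proof -
  have "fst (ys l) \<in> E" using assms(3) by auto
  moreover have "F \<gamma> y \<in> K" using F_interior[OF assms(1,2)] interior_subset by blast
  ultimately have "jet K 0 (fst (ys l)) (F \<gamma> y) (\<lambda>_. 0) = fst (ys l) (F \<gamma> y)"
    by (intro jet_0 E_Cr)
  with F_line_has_vector_derivative[OF assms(1) \<open>fst (ys l) \<in> E\<close> assms(2), of "snd (ys l)"]
  show ?thesis by (simp only: velocity_def Let_def fst_conv snd_conv divide_inverse)
qed

lemma has_real_derivative_vec_nth:
  "(f has_vector_derivative d) (at t) \<Longrightarrow> ((\<lambda>t. f t $ i) has_real_derivative d $ i) (at t)"
  unfolding has_real_derivative_iff_has_vector_derivative
  by (rule bounded_linear.has_vector_derivative[OF bounded_linear_vec_nth])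

text \<open>The directions up to k are frozen in \<Phi>; the new one, \<open>ys (Suc k)\<close>,
  enters \<Psi> as an argument. Base points are interior, where iterated derivatives live.\<close>

definition line_deriv where
  "line_deriv k \<Phi> \<Psi> \<longleftrightarrow> (\<forall>p ys. p \<in> Om \<times> interior K \<longrightarrow> ys \<in> {1..Suc k} \<rightarrow> E \<times> UNIV \<longrightarrow>
    ((\<lambda>t. \<Phi> (p + t *\<^sub>R ys (Suc k)) ys) has_real_derivative \<Psi> p ys) (at 0))"

lemma line_derivI:
  assumes "\<And>\<gamma> y ys. \<gamma> \<in> Om \<Longrightarrow> y \<in> interior K \<Longrightarrow> ys \<in> {1..Suc k} \<rightarrow> E \<times> UNIV \<Longrightarrow>
    ((\<lambda>t. \<Phi> (\<gamma> + t *\<^sub>R fst (ys (Suc k)), y + t *\<^sub>R snd (ys (Suc k))) ys) has_real_derivative \<Psi> (\<gamma>, y) ys) (at 0)"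
  shows "line_deriv k \<Phi> \<Psi>"
  unfolding line_deriv_def
proof (intro allI impI)
  fix p ys assume "p \<in> Om \<times> interior K" "ys \<in> {1..Suc k} \<rightarrow> E \<times> (UNIV :: (real ^ 'n) set)"
  then have "((\<lambda>t. \<Phi> (fst p + t *\<^sub>R fst (ys (Suc k)), snd p + t *\<^sub>R snd (ys (Suc k))) ys)
      has_real_derivative \<Psi> (fst p, snd p) ys) (at 0)"
    by (intro assms) auto
  moreover have "p + t *\<^sub>R ys (Suc k) = (fst p + t *\<^sub>R fst (ys (Suc k)), snd p + t *\<^sub>R snd (ys (Suc k)))" for t
    by (simp only: plus_prod_def scaleR_prod_def fst_conv snd_conv)
  ultimately show "((\<lambda>t. \<Phi> (p + t *\<^sub>R ys (Suc k)) ys) has_real_derivative \<Psi> p ys) (at 0)"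
    by (simp only: prod.collapse)
qed

text \<open>Induction over the generation of \<Phi>, with the chain rule at generators and the sum,
  product and reciprocal rules at the other steps. Both indices grow together, so iterating from (0,
  0) reaches the k-th derivative with jets of order at most k; \<open>enat (Suc m) \<le> r\<close>
  lets each jet be differentiated once more.\<close>

lemma jet_poly_line_deriv:
  assumes "jet_poly m k \<Phi>" "enat (Suc m) \<le> r"
  shows "\<exists>\<Psi>. jet_poly (Suc m) (Suc k) \<Psi> \<and> line_deriv k \<Phi> \<Psi>"
  using assms
proof (induction rule: jet_poly.induct)
  case (const m k c)
  have "line_deriv k (\<lambda>p ys. c) (\<lambda>p ys. 0)" by (rule line_derivI) simp
  then show ?case using jet_poly.const by blast
next
  case (base m k i)
  have "line_deriv k (\<lambda>p ys. F (fst p) (snd p) $ i) (velocity (Suc k) i)"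
  proof (rule line_derivI)
    fix \<gamma> y and ys :: "nat \<Rightarrow> (real ^ 'n \<Rightarrow> real ^ 'n) \<times> (real ^ 'n)"
    assume "\<gamma> \<in> Om" "y \<in> interior K" "ys \<in> {1..Suc k} \<rightarrow> E \<times> UNIV"
    then have "ys (Suc k) \<in> E \<times> UNIV" by (auto simp: Pi_iff)
    from has_real_derivative_vec_nth[OF F_velocity[where ys = ys, OF \<open>\<gamma> \<in> Om\<close> \<open>y \<in> interior K\<close> this], of i]
    show "((\<lambda>t. F (fst (\<gamma> + t *\<^sub>R fst (ys (Suc k)), y + t *\<^sub>R snd (ys (Suc k))))
        (snd (\<gamma> + t *\<^sub>R fst (ys (Suc k)), y + t *\<^sub>R snd (ys (Suc k)))) $ i) has_real_derivative
        velocity (Suc k) i (\<gamma>, y) ys) (at 0)"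
      by (simp only: fst_conv snd_conv vec_lambda_beta)
  qed
  moreover have "jet_poly (Suc m) (Suc k) (velocity (Suc k) i)"
    by (rule jet_poly_velocity) simp
  ultimately show ?case by blast
next
  case (base_jet a m k ws i)
  then have a: "enat (Suc a) \<le> r" using order_trans[of "enat (Suc a)" "enat (Suc m)" r] by simp
  let ?\<Psi> = "\<lambda>p ys. (\<Sum>j\<in>UNIV. velocity (Suc k) j p ys * jet K (Suc a) (fst p) (F (fst p) (snd p)) (ws(Suc a := axis j 1)) $ i)
      + jet K a (fst (ys (Suc k))) (F (fst p) (snd p)) ws $ i"
  have "line_deriv k (\<lambda>p ys. jet K a (fst p) (F (fst p) (snd p)) ws $ i) ?\<Psi>"
  proof (rule line_derivI)
    fix \<gamma> y and ys :: "nat \<Rightarrow> (real ^ 'n \<Rightarrow> real ^ 'n) \<times> (real ^ 'n)"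
    assume g: "\<gamma> \<in> Om" "y \<in> interior K" "ys \<in> {1..Suc k} \<rightarrow> E \<times> UNIV"
    then have ys: "ys (Suc k) \<in> E \<times> UNIV" by (auto simp: Pi_iff)
    then have "fst (ys (Suc k)) \<in> E" by auto
    from has_real_derivative_vec_nth[OF jet_line_F_line_has_vector_derivative[OF g(1) this g(2) a
          F_velocity[where ys = ys, OF g(1,2) ys]], of ws i]
    show "((\<lambda>t. jet K a (fst (\<gamma> + t *\<^sub>R fst (ys (Suc k)), y + t *\<^sub>R snd (ys (Suc k))))
        (F (fst (\<gamma> + t *\<^sub>R fst (ys (Suc k)), y + t *\<^sub>R snd (ys (Suc k))))
        (snd (\<gamma> + t *\<^sub>R fst (ys (Suc k)), y + t *\<^sub>R snd (ys (Suc k))))) ws $ i) has_real_derivative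
        ?\<Psi> (\<gamma>, y) ys) (at 0)"
      by (simp only: fst_conv snd_conv vec_lambda_beta vector_add_component sum_component
        vector_scaleR_component real_scaleR_def)
  qed
  moreover have "jet_poly (Suc m) (Suc k) ?\<Psi>"
    by (intro jet_poly.add jet_poly_sum jet_poly.mult jet_poly_velocity jet_poly.base_jet jet_poly.dir_jet)
      (use base_jet in auto)
  ultimately show ?case by blast
next
  case (dir_vec l k m i)
  have "line_deriv k (\<lambda>p ys. snd (ys l) $ i) (\<lambda>p ys. 0)" by (rule line_derivI) simp
  then show ?case using jet_poly.const by blast
next
  case (dir_jet a m l k ws i)
  then have a: "enat (Suc a) \<le> r" using order_trans[of "enat (Suc a)" "enat (Suc m)" r] by simp
  \<comment> \<open>The function \<open>fst (ys l)\<close> is frozen and only the point moves, hence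
    no second summand as for jets of the base function.\<close>
  let ?\<Psi> = "\<lambda>p ys. (\<Sum>j\<in>UNIV. velocity (Suc k) j p ys * jet K (Suc a) (fst (ys l)) (F (fst p) (snd p)) (ws(Suc a := axis j 1)) $ i)"
  have "line_deriv k (\<lambda>p ys. jet K a (fst (ys l)) (F (fst p) (snd p)) ws $ i) ?\<Psi>"
  proof (rule line_derivI)
    fix \<gamma> y and ys :: "nat \<Rightarrow> (real ^ 'n \<Rightarrow> real ^ 'n) \<times> (real ^ 'n)"
    assume g: "\<gamma> \<in> Om" "y \<in> interior K" "ys \<in> {1..Suc k} \<rightarrow> E \<times> UNIV"
    then have ys: "ys (Suc k) \<in> E \<times> UNIV" "ys l \<in> E \<times> UNIV" using dir_jet by (auto simp: Pi_iff)
    then have E: "fst (ys (Suc k)) \<in> E" "fst (ys l) \<in> E" by auto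
    from has_real_derivative_vec_nth[OF jet_F_line_has_vector_derivative[OF g(1) E(1) g(2) E_Cr[OF E(2)] a
          F_velocity[where ys = ys, OF g(1,2) ys(1)]], of ws i]
    show "((\<lambda>t. jet K a (fst (ys l))
        (F (fst (\<gamma> + t *\<^sub>R fst (ys (Suc k)), y + t *\<^sub>R snd (ys (Suc k))))
        (snd (\<gamma> + t *\<^sub>R fst (ys (Suc k)), y + t *\<^sub>R snd (ys (Suc k))))) ws $ i) has_real_derivative
        ?\<Psi> (\<gamma>, y) ys) (at 0)"
      by (simp only: fst_conv snd_conv vec_lambda_beta sum_component vector_scaleR_component real_scaleR_def)
  qed
  moreover have "jet_poly (Suc m) (Suc k) ?\<Psi>"
    by (intro jet_poly_sum jet_poly.mult jet_poly_velocity jet_poly.dir_jet)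
      (use dir_jet in auto)
  ultimately show ?case by blast
next
  case (add m k \<Phi> \<Psi>)
  from add.IH(1)[OF add.prems] add.IH(2)[OF add.prems]
  obtain \<Phi>' \<Psi>' where d: "jet_poly (Suc m) (Suc k) \<Phi>'" "line_deriv k \<Phi> \<Phi>'"
    "jet_poly (Suc m) (Suc k) \<Psi>'" "line_deriv k \<Psi> \<Psi>'" by (elim exE conjE)
  have "line_deriv k (\<lambda>p ys. \<Phi> p ys + \<Psi> p ys) (\<lambda>p ys. \<Phi>' p ys + \<Psi>' p ys)"
    using d(2,4) unfolding line_deriv_def by (auto intro!: DERIV_add)
  moreover have "jet_poly (Suc m) (Suc k) (\<lambda>p ys. \<Phi>' p ys + \<Psi>' p ys)"
    using d(1,3) by (rule jet_poly.add)
  ultimately show ?case by blast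
next
  case (mult m k \<Phi> \<Psi>)
  from mult.IH(1)[OF mult.prems] mult.IH(2)[OF mult.prems]
  obtain \<Phi>' \<Psi>' where d: "jet_poly (Suc m) (Suc k) \<Phi>'" "line_deriv k \<Phi> \<Phi>'"
    "jet_poly (Suc m) (Suc k) \<Psi>'" "line_deriv k \<Psi> \<Psi>'" by (elim exE conjE)
  let ?D = "\<lambda>p ys. \<Phi>' p ys * \<Psi> p ys + \<Psi>' p ys * \<Phi> p ys"
  have "line_deriv k (\<lambda>p ys. \<Phi> p ys * \<Psi> p ys) ?D"
    unfolding line_deriv_def
  proof (intro allI impI)
    fix p ys assume "p \<in> Om \<times> interior K" "ys \<in> {1..Suc k} \<rightarrow> E \<times> (UNIV :: (real ^ 'n) set)"
    with d(2,4) have "((\<lambda>t. \<Phi> (p + t *\<^sub>R ys (Suc k)) ys) has_real_derivative \<Phi>' p ys) (at 0)"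
      "((\<lambda>t. \<Psi> (p + t *\<^sub>R ys (Suc k)) ys) has_real_derivative \<Psi>' p ys) (at 0)"
      unfolding line_deriv_def by blast+
    from DERIV_mult[OF this]
    show "((\<lambda>t. \<Phi> (p + t *\<^sub>R ys (Suc k)) ys * \<Psi> (p + t *\<^sub>R ys (Suc k)) ys) has_real_derivative ?D p ys) (at 0)"
      by simp
  qed
  moreover have "jet_poly (Suc m) (Suc k) \<Phi>" "jet_poly (Suc m) (Suc k) \<Psi>"
    using mult.hyps by (auto elim!: jet_poly_mono)
  then have "jet_poly (Suc m) (Suc k) ?D"
    using d by (intro jet_poly.add jet_poly.mult)
  ultimately show ?case by blast
next
  case (inverse m k \<Phi>)
  from inverse.IH[OF inverse.prems]
  obtain \<Phi>' where d: "jet_poly (Suc m) (Suc k) \<Phi>'" "line_deriv k \<Phi> \<Phi>'" by (elim exE conjE)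
  let ?D = "\<lambda>p ys. - (inverse (\<Phi> p ys) * \<Phi>' p ys * inverse (\<Phi> p ys))"
  have "line_deriv k (\<lambda>p ys. inverse (\<Phi> p ys)) ?D"
    unfolding line_deriv_def
  proof (intro allI impI)
    fix p ys assume p: "p \<in> Om \<times> interior K" "ys \<in> {1..Suc k} \<rightarrow> E \<times> (UNIV :: (real ^ 'n) set)"
    with d(2) have "((\<lambda>t. \<Phi> (p + t *\<^sub>R ys (Suc k)) ys) has_real_derivative \<Phi>' p ys) (at 0)"
      unfolding line_deriv_def by blast
    moreover have "\<Phi> p ys \<noteq> 0"
      by (rule inverse.hyps) (use p interior_subset[of K] in \<open>auto simp: Pi_iff\<close>)
    then have "\<Phi> (p + 0 *\<^sub>R ys (Suc k)) ys \<noteq> 0" by simp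
    ultimately show "((\<lambda>t. inverse (\<Phi> (p + t *\<^sub>R ys (Suc k)) ys)) has_real_derivative ?D p ys) (at 0)"
      by (auto dest: DERIV_inverse')
  qed
  moreover have "jet_poly (Suc m) (Suc k) \<Phi>"
    using inverse.hyps(1) by (rule jet_poly_mono) auto
  then have "jet_poly (Suc m) (Suc k) (\<lambda>p ys. inverse (\<Phi> p ys))"
    by (rule jet_poly.inverse) (use inverse.hyps in \<open>auto simp: Pi_iff\<close>)
  then have "jet_poly (Suc m) (Suc k) ?D"
    using d by (intro jet_poly_minus jet_poly.mult)
  ultimately show ?case by blast
qed

section \<open>Continuity of the algebra up to the frontier\<close>

abbreviation "J k \<equiv> jet_top (prod_topology T euclidean) (Om \<times> K) k"

lemma topspace_J: "topspace (J k) = (Om \<times> K) \<times> ({1..k} \<rightarrow>\<^sub>E E \<times> UNIV)"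
  using Om_E by (auto simp: topspace_jet_top)

lemma continuous_map_J_base:
  "continuous_map (J k) (prod_topology (subtopology T Om) (top_of_set K)) fst"
  unfolding jet_top_def subtopology_Times by (rule continuous_map_fst)

lemma continuous_map_J_F: "continuous_map (J k) (top_of_set K) (\<lambda>q. F (fst (fst q)) (snd (fst q)))"
  using continuous_map_compose[OF continuous_map_J_base continuous_map_F] by (simp only: o_def)

lemma continuous_map_J_dir:
  assumes "l \<in> {1..k}"
  shows "continuous_map (J k) (prod_topology T euclidean) (\<lambda>q. snd q l)"
  unfolding jet_top_def power_top_def
  by (rule continuous_map_compose[OF continuous_map_snd continuous_map_product_projection[OF assms], unfolded o_def])

lemma continuous_map_vec_nth:
  assumes "continuous_map X euclidean f"
  shows "continuous_map X euclideanreal (\<lambda>q. f q $ i)"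
  by (rule continuous_map_compose[OF assms, of euclidean "\<lambda>v. v $ i", unfolded o_def])
    (simp add: continuous_on_component)

lemma continuous_map_J_jet:
  assumes "enat a \<le> r" "continuous_map (J k) T g"
  shows "continuous_map (J k) euclidean (\<lambda>q. jet K a (g q) (F (fst (fst q)) (snd (fst q))) ws)"
  using continuous_map_compose[OF continuous_map_pairedI[OF assms(2) continuous_map_J_F] continuous_map_jet[OF assms(1)]]
  by (simp add: o_def)

lemma jet_poly_continuous:
  assumes "jet_poly m k \<Phi>" "enat m \<le> r"
  shows "continuous_map (J k) euclideanreal (\<lambda>(p, ys). \<Phi> p ys)"
  using assms unfolding case_prod_unfold
proof (induction rule: jet_poly.induct)
  case (base m k i)
  show ?case
    by (rule continuous_map_vec_nth[OF continuous_map_into_fulltopology[OF continuous_map_J_F]])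
next
  case (base_jet a m k ws i)
  then have "enat a \<le> r" using order_trans[of "enat a" "enat m" r] by simp
  moreover have "continuous_map (J k) T (\<lambda>q. fst (fst q))"
    using continuous_map_compose[OF continuous_map_J_base continuous_map_fst]
    by (simp add: o_def continuous_map_in_subtopology)
  ultimately show ?case by (intro continuous_map_vec_nth continuous_map_J_jet)
next
  case (dir_vec l k m i)
  show ?case
    by (rule continuous_map_vec_nth[OF continuous_map_snd_of[OF continuous_map_J_dir[OF dir_vec(1)], unfolded o_def]])
next
  case (dir_jet a m l k ws i)
  then have "enat a \<le> r" using order_trans[of "enat a" "enat m" r] by simp
  moreover have "continuous_map (J k) T (\<lambda>q. fst (snd q l))"
    by (rule continuous_map_fst_of[OF continuous_map_J_dir[OF dir_jet(2)], unfolded o_def])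
  ultimately show ?case by (intro continuous_map_vec_nth continuous_map_J_jet)
next
  case (inverse m k \<Phi>)
  show ?case
  proof (rule continuous_map_real_inverse)
    fix q assume "q \<in> topspace (J k)"
    then have "fst q \<in> Om \<times> K" "snd q \<in> {1..k} \<rightarrow> E \<times> UNIV"
      unfolding topspace_J by (auto simp: Pi_iff PiE_iff)
    then show "\<Phi> (fst q) (snd q) \<noteq> 0" by (rule inverse.hyps)
  qed (use inverse in blast)
qed (auto intro: continuous_map_add continuous_map_real_mult)

text \<open>Coordinatewise candidates for all derivatives of the inversion, obtained by dependent
  choice from \<open>jet_poly_line_deriv\<close>. The same family serves for fixed and for variable
  \<gamma>.\<close>

lemma F_jets:
  obtains \<Phi> :: "nat \<Rightarrow> 'n \<Rightarrow> _" where "\<And>k i. jet_poly k k (\<Phi> k i)"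
    "\<And>i p ys. \<Phi> 0 i p ys = F (fst p) (snd p) $ i"
    "\<And>k i. enat (Suc k) \<le> r \<Longrightarrow> line_deriv k (\<Phi> k i) (\<Phi> (Suc k) i)"
proof -
  let ?P = "\<lambda>i k \<Phi>. jet_poly k k \<Phi> \<and> (k = 0 \<longrightarrow> \<Phi> = (\<lambda>p ys. F (fst p) (snd p) $ i))"
  have "\<exists>\<Phi>. \<forall>k. ?P i k (\<Phi> k) \<and> (enat (Suc k) \<le> r \<longrightarrow> line_deriv k (\<Phi> k) (\<Phi> (Suc k)))" for i
  proof (rule dependent_nat_choice)
    show "\<exists>\<Phi>. ?P i 0 \<Phi>" using jet_poly.base by blast
    fix \<Phi> k assume "?P i k \<Phi>"
    \<comment> \<open>Beyond order r nothing is demanded of the successor, and a constant fills the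
      sequence.\<close>
    then have "\<exists>\<Psi>. jet_poly (Suc k) (Suc k) \<Psi> \<and> (enat (Suc k) \<le> r \<longrightarrow> line_deriv k \<Phi> \<Psi>)"
      using jet_poly_line_deriv jet_poly.const by blast
    then show "\<exists>\<Psi>. ?P i (Suc k) \<Psi> \<and> (enat (Suc k) \<le> r \<longrightarrow> line_deriv k \<Phi> \<Psi>)" by simp
  qed
  then have "\<forall>i. \<exists>\<Phi>. \<forall>k. ?P i k (\<Phi> k) \<and> (enat (Suc k) \<le> r \<longrightarrow> line_deriv k (\<Phi> k) (\<Phi> (Suc k)))" ..
  from choice[OF this] obtain \<Phi> where \<Phi>: "\<And>i k. ?P i k (\<Phi> i k)"
    "\<And>i k. enat (Suc k) \<le> r \<longrightarrow> line_deriv k (\<Phi> i k) (\<Phi> i (Suc k))" by blast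
  show thesis
    by (rule that[of "\<lambda>k i. \<Phi> i k"]) (use \<Phi> in auto)
qed

end

section \<open>The inversion is of class C^r\<close>

lemma continuous_map_vec_lambda:
  assumes "\<And>i. continuous_map X euclideanreal (f i)"
  shows "continuous_map X euclidean (\<lambda>q. \<chi> i. f i q)"
  using assms by (auto simp: continuous_map_atin intro: tendsto_vec_lambda)

lemma has_dir_deriv_vec_lambda:
  assumes "\<And>i. ((\<lambda>t. f i (x + t *\<^sub>R y)) has_real_derivative l i) (at 0)"
  shows "has_dir_deriv euclidean (\<lambda>z. \<chi> i. f i z) y x (\<chi> i. l i)"
proof -
  have "((\<lambda>t. (1 / t) *\<^sub>R (f i (x + t *\<^sub>R y) - f i x)) \<longlongrightarrow> l i) (at 0)" for i
    using has_dir_deriv_euclidean[of "f i" y x "l i"] assms[of i]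
    unfolding has_dir_deriv_def limitin_canonical_iff has_real_derivative_iff_has_vector_derivative
    by blast
  then have "((\<lambda>t. \<chi> i. (1 / t) *\<^sub>R (f i (x + t *\<^sub>R y) - f i x)) \<longlongrightarrow> (\<chi> i. l i)) (at 0)"
    by (rule tendsto_vec_lambda)
  moreover have "(\<chi> i. (1 / t) *\<^sub>R (f i (x + t *\<^sub>R y) - f i x)) =
      (1 / t) *\<^sub>R ((\<chi> i. f i (x + t *\<^sub>R y)) - (\<chi> i. f i x))" for t
    by (simp add: vec_eq_iff)
  ultimately show ?thesis unfolding has_dir_deriv_def limitin_canonical_iff by simp
qed

context convex_body
begin

text \<open>Freezing \<gamma> means using the directions (0, v), so the derivatives of
  \<open>F \<gamma>\<close> are those of the inversion at such tuples.\<close>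

lemma Cr_F:
  assumes "\<gamma> \<in> Om"
  shows "Cr (F \<gamma>)"
proof -
  obtain \<Phi> :: "nat \<Rightarrow> 'n \<Rightarrow> _" where \<Phi>: "\<And>k i. jet_poly k k (\<Phi> k i)"
    "\<And>i p ys. \<Phi> 0 i p ys = F (fst p) (snd p) $ i"
    "\<And>k i. enat (Suc k) \<le> r \<Longrightarrow> line_deriv k (\<Phi> k i) (\<Phi> (Suc k) i)"
    using F_jets by blast
  let ?z = "\<lambda>vs l. (0 :: real ^ 'n \<Rightarrow> real ^ 'n, vs l)"
  define h where "h k q = (\<chi> i. \<Phi> k i (\<gamma>, fst q) (?z (snd q)))" for k and q :: "(real ^ 'n) \<times> (nat \<Rightarrow> real ^ 'n)"
  show ?thesis
  proof (rule Cr_onI(1)[where h = h, OF _ _ interior_K_dense locally_convex_K])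
    fix k assume k: "enat k \<le> r"
    have "continuous_map (jet_top euclidean K k) euclideanreal (\<lambda>q. \<Phi> k i (\<gamma>, fst q) (?z (snd q)))" for i
    proof -
      \<comment> \<open>Points of \<open>J k\<close> have extensional tuples; the restriction is
        removed afterwards by \<open>jet_poly_cong\<close>.\<close>
      let ?g = "\<lambda>q. ((\<gamma>, fst q), \<lambda>l\<in>{1..k}. ?z (snd q) l)"
      have 1: "continuous_map (jet_top euclidean K k) (prod_topology (subtopology T Om) (top_of_set K)) (\<lambda>q. (\<gamma>, fst q))"
        unfolding jet_top_def
        by (intro continuous_map_pairedI continuous_map_fst) (simp add: assms Om_E)
      have "continuous_map (jet_top euclidean K k) euclidean (\<lambda>q. snd q l)" if "l \<in> {1..k}" for l
        unfolding jet_top_def power_top_def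
        by (rule continuous_map_compose[OF continuous_map_snd continuous_map_product_projection[OF that], unfolded o_def])
      then have 2: "continuous_map (jet_top euclidean K k) (product_topology (\<lambda>_. prod_topology T euclidean) {1..k})
          (\<lambda>q. \<lambda>l\<in>{1..k}. ?z (snd q) l)"
        by (subst continuous_map_componentwise) (auto intro!: continuous_map_pairedI simp: zero_E)
      have "continuous_map (jet_top euclidean K k) (J k) ?g"
        unfolding jet_top_def[of "prod_topology T euclidean"] power_top_def subtopology_Times
        by (rule continuous_map_pairedI[OF 1 2])
      from continuous_map_compose[OF this jet_poly_continuous[OF \<Phi>(1) k, of i]]
      have "continuous_map (jet_top euclidean K k) euclideanreal (\<lambda>q. \<Phi> k i (\<gamma>, fst q) (\<lambda>l\<in>{1..k}. ?z (snd q) l))"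
        by (simp only: o_def prod.case)
      moreover have "\<Phi> k i p (\<lambda>l\<in>{1..k}. ?z vs l) = \<Phi> k i p (?z vs)" for p vs
        by (rule jet_poly_cong[OF \<Phi>(1)]) simp
      ultimately show ?thesis by (simp only:)
    qed
    then show "continuous_map (jet_top euclidean K k) euclidean (h k)"
      unfolding h_def[abs_def] by (rule continuous_map_vec_lambda)
  next
    fix x
    show "h 0 (x, \<lambda>_. undefined) = F \<gamma> x" by (simp add: h_def \<Phi>(2) vec_eq_iff)
  next
    fix k x and ys :: "nat \<Rightarrow> real ^ 'n"
    assume k: "enat (Suc k) \<le> r" and "x \<in> euclidean interior_of K"
    then have x: "(\<gamma>, x) \<in> Om \<times> interior K" using assms by simp
    have ys: "?z ys \<in> {1..Suc k} \<rightarrow> E \<times> UNIV" using zero_E by simp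
    have "((\<lambda>t. \<Phi> k i (\<gamma>, x + t *\<^sub>R ys (Suc k)) (?z ys)) has_real_derivative \<Phi> (Suc k) i (\<gamma>, x) (?z ys)) (at 0)" for i
    proof -
      have "((\<lambda>t. \<Phi> k i ((\<gamma>, x) + t *\<^sub>R ?z ys (Suc k)) (?z ys)) has_real_derivative \<Phi> (Suc k) i (\<gamma>, x) (?z ys)) (at 0)"
        using \<Phi>(3)[OF k, of i] x ys unfolding line_deriv_def by blast
      moreover have "(\<gamma>, x) + t *\<^sub>R ?z ys (Suc k) = (\<gamma>, x + t *\<^sub>R ys (Suc k))" for t
        by (simp only: scaleR_Pair add_Pair scaleR_zero_right add_0_right)
      ultimately show ?thesis by (simp only:)
    qed
    then have "has_dir_deriv euclidean (\<lambda>z. \<chi> i. \<Phi> k i (\<gamma>, z) (?z ys)) (ys (Suc k)) x (\<chi> i. \<Phi> (Suc k) i (\<gamma>, x) (?z ys))"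
      by (rule has_dir_deriv_vec_lambda)
    moreover have "\<Phi> k i p (?z (restrict ys {1..k})) = \<Phi> k i p (?z ys)" for i p
      by (rule jet_poly_cong[OF \<Phi>(1)]) simp
    ultimately show "has_dir_deriv euclidean (\<lambda>z. h k (z, restrict ys {1..k})) (ys (Suc k)) x (h (Suc k) (x, ys))"
      unfolding h_def by (simp only: fst_conv snd_conv)
  qed (auto intro: interior_path)
qed

text \<open>The derivatives are x, then the first direction, then zero. Together with
  \<open>Cr_lincomb\<close> this lets C^r pass between a diffeomorphism and its
  displacement.\<close>

lemma Cr_ident: "Cr (\<lambda>x. x)"
proof (rule Cr_onI(1)[OF _ _ interior_K_dense locally_convex_K,
      where h = "\<lambda>k q. if k = 0 then fst q else if k = 1 then snd q 1 else 0"])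
  fix k
  have "continuous_map (jet_top euclidean K k) euclidean (\<lambda>q. snd q 1)" if "k = 1"
    unfolding jet_top_def power_top_def
    by (rule continuous_map_compose[OF continuous_map_snd continuous_map_product_projection, unfolded o_def])
      (simp add: that)
  moreover have "continuous_map (jet_top euclidean K k) euclidean fst"
    unfolding jet_top_def
    by (rule continuous_map_into_fulltopology[OF continuous_map_fst])
  ultimately show "continuous_map (jet_top euclidean K k) euclidean
      (\<lambda>q. if k = 0 then fst q else if k = 1 then snd q 1 else 0)"
    by (cases "k = 0"; cases "k = 1") auto
next
  fix k x and ys :: "nat \<Rightarrow> real ^ 'n"
  show "has_dir_deriv euclidean
      (\<lambda>z. if k = 0 then fst (z, restrict ys {1..k}) else if k = 1 then snd (z, restrict ys {1..k}) 1 else 0) (ys (Suc k)) x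
      (if Suc k = 0 then fst (x, ys) else if Suc k = 1 then snd (x, ys) 1 else 0)"
    unfolding has_dir_deriv_euclidean fst_conv snd_conv
    by (cases "k = 0"; cases "k = 1") (auto intro!: derivative_eq_intros)
qed (auto intro: interior_path)

lemma inv_into_cong: "(\<And>x. x \<in> A \<Longrightarrow> f x = g x) \<Longrightarrow> inv_into A f = inv_into A g"
  unfolding inv_into_def fun_eq_iff by (intro allI arg_cong[where f = Eps]) auto

text \<open>Smoothness of the inverse is traded for the lower bound in one direction by
  \<open>Cr_Lipschitz\<close>, and recovered in the other by \<open>Cr_F\<close>.\<close>

lemma Omega_eq_Om: "Omega r K = Om"
proof
  show "Omega r K \<subseteq> Om"
  proof
    fix \<gamma> assume "\<gamma> \<in> Omega r K"
    then obtain \<phi> where \<gamma>: "\<gamma> = Diff_chart K \<phi>" and \<phi>: "bij_betw \<phi> K K" "Cr \<phi>" "Cr (inv_into K \<phi>)"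
      "\<And>x. x \<in> frontier K \<Longrightarrow> \<phi> x = x"
      by (auto simp: Omega_def Diff_bd_def)
    have eq: "x + \<gamma> x = \<phi> x" if "x \<in> K" for x using that by (simp add: \<gamma> Diff_chart_def)
    have "Cr \<gamma>"
      by (rule Cr_lincomb(1)[OF \<phi>(2) Cr_ident, of _ 1 "-1"]) (simp add: \<gamma> Diff_chart_def)
    moreover have "\<gamma> x = 0" if "x \<notin> interior K" for x
      using that \<phi>(4)[of x] closure_subset[of K] by (auto simp: \<gamma> Diff_chart_def frontier_def)
    ultimately have E: "\<gamma> \<in> E" by (simp add: E_iff)
    have "(\<lambda>x. x + \<gamma> x) ` K = \<phi> ` K" using eq by (intro image_cong) auto
    then have im: "(\<lambda>x. x + \<gamma> x) ` K = K" using bij_betw_imp_surj_on[OF \<phi>(1)] by simp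
    obtain M where M: "M > 0" "\<And>x j. x \<in> K \<Longrightarrow> norm (partial j (inv_into K \<phi>) x) \<le> M"
      using partial_bounded[OF \<phi>(3)] by blast
    \<comment> \<open>The Lipschitz constant of the inverse from \<open>Cr_Lipschitz\<close>; its
      reciprocal is the lower bound for id + \<gamma>.\<close>
    define L where "L = real CARD('n) * M"
    have L: "L > 0" using M(1) by (simp add: L_def)
    have low: "1/L * norm (x - y) \<le> norm ((x + \<gamma> x) - (y + \<gamma> y))" if xy: "x \<in> K" "y \<in> K" for x y
    proof -
      have "norm (inv_into K \<phi> (\<phi> x) - inv_into K \<phi> (\<phi> y)) \<le> L * norm (\<phi> x - \<phi> y)"
        unfolding L_def
        by (rule Cr_Lipschitz[OF \<phi>(3) M(2)]) (use \<phi>(1) xy in \<open>auto simp: bij_betw_apply\<close>)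
      moreover have "inv_into K \<phi> (\<phi> x) = x" if "x \<in> K" for x
        by (rule bij_betw_inv_into_left[OF \<phi>(1) that])
      ultimately have "norm (x - y) \<le> L * norm (\<phi> x - \<phi> y)" using xy by simp
      then show ?thesis using L by (simp add: eq xy field_simps)
    qed
    have "1/L > 0" using L by simp
    with low have "\<exists>c>0. \<forall>x\<in>K. \<forall>y\<in>K. c * norm (x - y) \<le> norm ((x + \<gamma> x) - (y + \<gamma> y))" by blast
    then show "\<gamma> \<in> Om" unfolding Om_def mem_Collect_eq by (intro conjI E im)
  qed
  show "Om \<subseteq> Omega r K"
  proof
    fix \<gamma> assume g: "\<gamma> \<in> Om"
    define \<phi> where "\<phi> = restrict (\<lambda>x. x + \<gamma> x) K"
    have zero: "\<gamma> x = 0" if "x \<notin> interior K" for x using Om_E[OF g] that by (simp add: E_iff)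
    have "Diff_chart K \<phi> = \<gamma>"
      using zero interior_subset[of K] by (auto simp: Diff_chart_def \<phi>_def fun_eq_iff)
    moreover have "\<phi> \<in> Diff_bd r K"
      unfolding Diff_bd_def mem_Collect_eq
    proof (intro conjI ballI)
      show "\<phi> \<in> extensional K" by (simp add: \<phi>_def)
      have "bij_betw (\<lambda>x. x + \<gamma> x) K K"
        unfolding bij_betw_def using Om_inj[OF g] Om_image[OF g] by (rule conjI)
      then show "bij_betw \<phi> K K" by (simp add: \<phi>_def cong: bij_betw_cong)
      show "Cr \<phi>"
        by (rule Cr_lincomb(1)[OF Cr_ident E_Cr[OF Om_E[OF g]], of _ 1 1]) (simp add: \<phi>_def)
      have "inv_into K \<phi> = F \<gamma>"
        unfolding F_def by (rule inv_into_cong) (simp add: \<phi>_def)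
      then show "Cr (inv_into K \<phi>)" using Cr_F[OF g] by simp
      fix x assume "x \<in> frontier K"
      then have "x \<in> K" "x \<notin> interior K"
        using compact_imp_closed[OF compact] by (auto simp: frontier_def)
      then show "\<phi> x = x" using zero by (simp add: \<phi>_def)
    qed
    ultimately show "\<gamma> \<in> Omega r K" unfolding Omega_def by (metis imageI)
  qed
qed

section \<open>The inversion in both variables\<close>

lemma interior_of_Om_Times: "prod_topology T euclidean interior_of (Om \<times> K) = Om \<times> interior K"
  by (simp add: interior_of_Times interior_of_openin openin_Om)

lemma Cr_on_F:
  "Cr_on r (prod_topology T euclidean) (Om \<times> K) euclidean (\<lambda>(\<gamma>, y). F \<gamma> y)"
proof -
  obtain \<Phi> :: "nat \<Rightarrow> 'n \<Rightarrow> _" where \<Phi>: "\<And>k i. jet_poly k k (\<Phi> k i)"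
    "\<And>i p ys. \<Phi> 0 i p ys = F (fst p) (snd p) $ i"
    "\<And>k i. enat (Suc k) \<le> r \<Longrightarrow> line_deriv k (\<Phi> k i) (\<Phi> (Suc k) i)"
    using F_jets by blast
  define h where "h k = (\<lambda>(p, ys). \<chi> i. \<Phi> k i p ys)" for k
  show ?thesis
  proof (rule Cr_onI(1)[where h = h])
    show "Om \<times> K \<subseteq> topspace (prod_topology T euclidean)"
      using Om_E by auto
    have "Om \<subseteq> T closure_of Om" using Om_E by (intro closure_of_subset) blast
    then show "Om \<times> K \<subseteq> prod_topology T euclidean closure_of
        (prod_topology T euclidean interior_of (Om \<times> K))"
      unfolding interior_of_Om_Times closure_of_Times by (auto simp: closure_interior_K)
    show "locally_convex_in (prod_topology T euclidean) (Om \<times> K)"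
      unfolding locally_convex_in_def
    proof
      fix p assume "p \<in> Om \<times> K"
      then have p: "fst p \<in> Om" "snd p \<in> K" by auto
      from Om_nbhd[OF p(1)] obtain e where e: "e > 0" "C1_nbhd (fst p) e \<subseteq> Om" .
      let ?W = "C1_nbhd (fst p) e \<times> K"
      have "openin (subtopology T Om) (C1_nbhd (fst p) e)"
        using openin_C1_nbhd[OF Om_E[OF p(1)]] e(2) by (simp add: openin_subset_topspace_eq openin_open_subtopology openin_Om)
      then have "openin (subtopology (prod_topology T euclidean) (Om \<times> K)) ?W"
        by (simp add: subtopology_Times openin_prod_Times_iff)
      moreover have "p \<in> ?W" using p C1_nbhd_self[OF Om_E[OF p(1)] e(1)] by (simp add: mem_Times_iff)
      moreover have "convex ?W" by (intro convex_Times convex_C1_nbhd convex)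
      ultimately show "\<exists>W N. openin (subtopology (prod_topology T euclidean) (Om \<times> K)) W \<and>
          p \<in> W \<and> W \<subseteq> N \<and> N \<subseteq> Om \<times> K \<and> convex N"
        using e(2) by (intro exI[of _ ?W] conjI) auto
    qed
    show "continuous_map (J k) euclidean (h k)" if "enat k \<le> r" for k
      unfolding h_def case_prod_unfold
      by (rule continuous_map_vec_lambda) (rule jet_poly_continuous[OF \<Phi>(1) that, unfolded case_prod_unfold])
    show "h 0 (p, \<lambda>_. undefined) = (\<lambda>(\<gamma>, y). F \<gamma> y) p" for p
      by (simp add: h_def \<Phi>(2) vec_eq_iff case_prod_unfold)
    show "\<forall>\<^sub>F t in at 0. p + t *\<^sub>R q \<in> prod_topology T euclidean interior_of (Om \<times> K)"
      if "p \<in> prod_topology T euclidean interior_of (Om \<times> K)" "q \<in> topspace (prod_topology T euclidean)" for p q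
    proof -
      have "fst p \<in> Om" "fst q \<in> E" "snd p \<in> interior K"
        using that unfolding interior_of_Om_Times by auto
      from eventually_line[OF this, of "snd q"] show ?thesis
        unfolding interior_of_Om_Times by (rule eventually_mono) (simp add: mem_Times_iff)
    qed
    fix k p and ys :: "nat \<Rightarrow> (real ^ 'n \<Rightarrow> real ^ 'n) \<times> (real ^ 'n)"
    assume k: "enat (Suc k) \<le> r" and "p \<in> prod_topology T euclidean interior_of (Om \<times> K)"
      and "ys \<in> {1..Suc k} \<rightarrow>\<^sub>E topspace (prod_topology T euclidean)"
    then have p: "p \<in> Om \<times> interior K" and ys: "ys \<in> {1..Suc k} \<rightarrow> E \<times> UNIV"
      by (auto simp: interior_of_Om_Times PiE_def)
    have "((\<lambda>t. \<Phi> k i (p + t *\<^sub>R ys (Suc k)) ys) has_real_derivative \<Phi> (Suc k) i p ys) (at 0)" for i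
      using \<Phi>(3)[OF k, of i] p ys unfolding line_deriv_def by blast
    then have "has_dir_deriv euclidean (\<lambda>z. \<chi> i. \<Phi> k i z ys) (ys (Suc k)) p (\<chi> i. \<Phi> (Suc k) i p ys)"
      by (rule has_dir_deriv_vec_lambda)
    moreover have "\<Phi> k i z (restrict ys {1..k}) = \<Phi> k i z ys" for i z
      by (rule jet_poly_cong[OF \<Phi>(1)]) simp
    ultimately show "has_dir_deriv euclidean (\<lambda>z. h k (z, restrict ys {1..k})) (ys (Suc k)) p (h (Suc k) (p, ys))"
      unfolding h_def by (simp only: prod.case)
  qed simp
qed

end

theorem mainTheorem7:
  fixes K :: "(real ^ 'n) set" and r :: enat
  assumes "compact K" and "convex K" and "interior K \<noteq> {}" and "1 \<le> r"
  shows "Cr_on r (prod_topology (Cr_bd_top r K) euclidean) (Omega r K \<times> K) euclidean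
           (\<lambda>(\<gamma>, y). inv_into K (\<lambda>x. x + \<gamma> x) y)"
proof -
  \<comment> \<open>What remains is to rewrite \<open>Omega\<close> as \<open>Om\<close> and
    \<open>F\<close> as the inverse of id + \<gamma>.\<close>
  interpret convex_body K r by standard fact+
  show ?thesis using Cr_on_F unfolding F_def Omega_eq_Om .
qed

end
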